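(* The function $\mathfrak{r}$ (defined in the context) admits the following discontinuities. (i) Let $q>1$, $p\in(0,1)$ and $0<\delta<\lambda<\frac12$, and suppose that $\delta$ is small enough that \[\frac{\log\min\{p^q,(1-p)^q\}}{\log\sqrt{\lambda\delta}}<\frac{\log(p^q+(1-p)^q)}{\log\lambda}.\] Then the function $(A_1,A_2)\mapsto\mathfrak{r}_q(A_1,A_2,p)$ is discontinuous at the pair \[A_1:=\begin{pmatrix}\lambda&0\\0&\delta\end{pmatrix},\qquad A_2:=\begin{pmatrix}\lambda&0\\0&\lambda\end{pmatrix}.\] (ii) Suppose that the Bochi-Fayad Conjecture (stated in the context) is true. Then there exists a set $X\subseteq M_2(\mathbb{R})^2$ with positive Lebesgue measure with the following properties: $\|A_1\|,\|A_2\|<\frac12$ for all $(A_1,A_2)\in X$, and there exists $Q>1$ such that for all $p\in[\frac12,1)$ and all $q>Q$, the function $(A_1,A_2)\mapsto\mathfrak{r}_q(A_1,A_2,p)$ is discontinuous at every point of $X$.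
   Context: $M_2(\mathbb{R})$ denotes the set of all $2\times2$ real matrices and $\|\cdot\|$ is the Euclidean operator norm. For $A\in M_2(\mathbb{R})$, the singular values $\sigma_1(A)\geq\sigma_2(A)\geq0$ are the non-negative square roots of the eigenvalues of $A^*A$. For $s>0$ define \[\varphi^s(A):=\begin{cases}\sigma_1(A)^s,&0<s\leq1,\\ \sigma_1(A)\sigma_2(A)^{s-1},&1\leq s\leq2,\\ |\det A|^{s/2},&s\geq2.\end{cases}\] For $q>1$, $p\in(0,1)$ and invertible $A_1,A_2\in M_2(\mathbb{R})$ with $\|A_1\|,\|A_2\|<1$, put $p_1:=p$, $p_2:=1-p$ and define \[\mathfrak{r}_q(A_1,A_2,p):=\sup\left\{s>0\colon\sum_{n=1}^\infty\sum_{i_1,\ldots,i_n=1}^2\varphi^s(A_{i_1}\cdots A_{i_n})^{1-q}p_{i_1}^q\cdots p_{i_n}^q<\infty\right\}.\] The function $(A_1,A_2)\mapsto\mathfrak{r}_q(A_1,A_2,p)$ is considered, for fixed $q$ and $p$, on the open set $U\subset M_2(\mathbb{R})^2$ of pairs of invertible matrices with $\|A_1\|,\|A_2\|<1$; to say that it is discontinuous at a point means that the point belongs to $U$ and the function is not continuous there. Lebesgue measure on $M_2(\mathbb{R})^2$ is that of $\mathbb{R}^8$. Resistant pairs: a pair $(A_1,A_2)$ of $2\times 2$ real matrices is $(c,\varepsilon,\lambda)$-resistant if for all $n\geq1$ and all choices of $i_1,\ldots,i_n\in\{1,2\}$ such that at most $\varepsilon n$ of the integers $i_k$ are equal to $2$,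 we have $\|A_{i_1}\cdots A_{i_n}\|\geq c\lambda^n$. The pair is resistant if it is $(c,\varepsilon,\lambda)$-resistant for some $c,\varepsilon>0$ and some $\lambda>1$. Bochi-Fayad Conjecture: let $\mathcal{H}$ denote the set of all $2\times2$ real matrices with unit determinant and unequal real eigenvalues, and let $\mathcal{E}$ denote the set of all $2\times2$ real matrices with unit determinant and non-real eigenvalues. Then the set of resistant pairs $(A_1,A_2)\in\mathcal{H}\times\mathcal{E}$ has full Lebesgue measure. (Here $\mathcal{H}$ and $\mathcal{E}$ are open subsets of the $3$-dimensional manifold $\mathrm{SL}(2,\mathbb{R})$, and full Lebesgue measure means that the complement in $\mathcal{H}\times\mathcal{E}$ is null for the smooth measure class.) *)

theory Defs
  imports "HOL-Analysis.Analysis"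
begin

type_synonym mat2 = "real^2^2"

definition opnorm :: "mat2 \<Rightarrow> real" where
  "opnorm A = onorm ((*v) A)"

definition eigenvalue :: "'a::field^'n^'n \<Rightarrow> 'a \<Rightarrow> bool" where
  "eigenvalue A z \<longleftrightarrow> (\<exists>v. v \<noteq> 0 \<and> A *v v = z *s v)"

text \<open>For a \<open>2 \<times> 2\<close> matrix, the largest and the smallest eigenvalue of the symmetric matrix
  \<open>A\<^sup>T A\<close> are its two eigenvalues counted with multiplicity.\<close>

definition sigma1 :: "mat2 \<Rightarrow> real" where
  "sigma1 A = sqrt (Max {t. eigenvalue (transpose A ** A) t})"

definition sigma2 :: "mat2 \<Rightarrow> real" where
  "sigma2 A = sqrt (Min {t. eigenvalue (transpose A ** A) t})"

definition phi :: "real \<Rightarrow> mat2 \<Rightarrow> real" where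
  "phi s A =
    (if s \<le> 1 then sigma1 A powr s
     else if s \<le> 2 then sigma1 A * sigma2 A powr (s - 1)
     else \<bar>det A\<bar> powr (s / 2))"

definition words :: "nat \<Rightarrow> nat list set" where
  "words n = {w. length w = n \<and> set w \<subseteq> {1, 2}}"

definition word_prod :: "mat2 \<Rightarrow> mat2 \<Rightarrow> nat list \<Rightarrow> mat2" where
  "word_prod A1 A2 w = foldr (\<lambda>i B. (if i = 1 then A1 else A2) ** B) w (mat 1)"

definition word_weight :: "real \<Rightarrow> real \<Rightarrow> nat list \<Rightarrow> real" where
  "word_weight q p w = prod_list (map (\<lambda>i. (if i = 1 then p else 1 - p) powr q) w)"

text \<open>On \<open>pair_domain\<close>, and for \<open>q > 1\<close> and \<open>0 < p < 1\<close>, the set below is nonempty (it contains all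
  small \<open>s > 0\<close>) and bounded above, so the real supremum is the true one. All terms of the series
  are nonnegative, so summability says that its sum is finite.\<close>

definition r_dim :: "real \<Rightarrow> mat2 \<Rightarrow> mat2 \<Rightarrow> real \<Rightarrow> real" where
  "r_dim q A1 A2 p =
    Sup {s. s > 0 \<and>
      summable (\<lambda>n. \<Sum>w\<in>words (Suc n). phi s (word_prod A1 A2 w) powr (1 - q) * word_weight q p w)}"

definition pair_domain :: "(mat2 \<times> mat2) set" where
  "pair_domain = {(A1, A2). invertible A1 \<and> invertible A2 \<and> opnorm A1 < 1 \<and> opnorm A2 < 1}"

definition r_discontinuous_at :: "real \<Rightarrow> real \<Rightarrow> mat2 \<times> mat2 \<Rightarrow> bool" where
  "r_discontinuous_at q p P \<longleftrightarrow>
    P \<in> pair_domain \<and>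
    \<not> continuous (at P within pair_domain) (\<lambda>(A1, A2). r_dim q A1 A2 p)"

definition resistant_with :: "real \<Rightarrow> real \<Rightarrow> real \<Rightarrow> mat2 \<Rightarrow> mat2 \<Rightarrow> bool" where
  "resistant_with c e l A1 A2 \<longleftrightarrow>
    (\<forall>n\<ge>1. \<forall>w\<in>words n. real (count_list w 2) \<le> e * real n \<longrightarrow>
      opnorm (word_prod A1 A2 w) \<ge> c * l ^ n)"

definition resistant :: "mat2 \<Rightarrow> mat2 \<Rightarrow> bool" where
  "resistant A1 A2 \<longleftrightarrow> (\<exists>c e l. c > 0 \<and> e > 0 \<and> l > 1 \<and> resistant_with c e l A1 A2)"

definition hyperbolic :: "mat2 set" where
  "hyperbolic = {A. det A = 1 \<and> (\<exists>x y. x \<noteq> y \<and> eigenvalue A x \<and> eigenvalue A y)}"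

definition elliptic :: "mat2 set" where
  "elliptic = {A. det A = 1 \<and> (\<forall>z. eigenvalue (map_matrix complex_of_real A) z \<longrightarrow> z \<notin> \<real>)}"

text \<open>\<open>k\<close> times continuously differentiable on an open set \<open>S\<close>: all iterated directional
  derivatives up to order \<open>k\<close> exist and are continuous.\<close>

primrec Ck_on :: "nat \<Rightarrow> 'a::euclidean_space set \<Rightarrow> ('a \<Rightarrow> 'b::euclidean_space) \<Rightarrow> bool" where
  "Ck_on 0 S f = continuous_on S f"
| "Ck_on (Suc k) S f =
    ((\<forall>x\<in>S. f differentiable (at x)) \<and> (\<forall>v. Ck_on k S (\<lambda>x. frechet_derivative f (at x) v)))"

definition smooth_on :: "'a::euclidean_space set \<Rightarrow> ('a \<Rightarrow> 'b::euclidean_space) \<Rightarrow> bool" where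
  "smooth_on S f \<longleftrightarrow> (\<forall>k. Ck_on k S f)"

text \<open>A local parametrization of an embedded submanifold \<open>M\<close>: a smooth immersion of an open set
  \<open>W\<close> that is a homeomorphism onto a relatively open part of \<open>M\<close> (an inverse chart).\<close>

definition local_parametrization ::
  "'b::euclidean_space set \<Rightarrow> 'a::euclidean_space set \<Rightarrow> ('a \<Rightarrow> 'b) \<Rightarrow> bool" where
  "local_parametrization M W \<psi> \<longleftrightarrow>
    open W \<and> smooth_on W \<psi> \<and> (\<forall>x\<in>W. inj (frechet_derivative \<psi> (at x))) \<and>
    openin (top_of_set M) (\<psi> ` W) \<and> (\<exists>\<phi>. homeomorphism W (\<psi> ` W) \<psi> \<phi>)"

text \<open>\<open>N\<close> is null for the smooth measure class of the embedded submanifold \<open>M\<close>, whose dimension is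
  \<open>CARD('k)\<close>: it is Lebesgue null in every chart.\<close>

definition null_in_submanifold ::
  "'k::finite itself \<Rightarrow> 'b::euclidean_space set \<Rightarrow> 'b set \<Rightarrow> bool" where
  "null_in_submanifold K M N \<longleftrightarrow>
    (\<forall>W (\<psi> :: real^'k \<Rightarrow> 'b). local_parametrization M W \<psi> \<longrightarrow>
      {x \<in> W. \<psi> x \<in> N} \<in> null_sets lebesgue)"

definition Bochi_Fayad_conjecture :: bool where
  "Bochi_Fayad_conjecture \<longleftrightarrow>
    null_in_submanifold TYPE(6) (hyperbolic \<times> elliptic)
      {(A1, A2). (A1, A2) \<in> hyperbolic \<times> elliptic \<and> \<not> resistant A1 A2}"

end

theory Submission
  imports Defs
begin

text \<open>At the pairs considered, \<open>A1\<close> has two real eigenvalues of equal sign and \<open>A2\<close> is a scalar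
  multiple of a matrix conjugate to a rotation. An arbitrarily small change of the rotation angle
  makes some power \<open>A2 ^ m\<close> map the expanding eigenline of \<open>A1\<close> to the contracting one. Then
  \<open>W = A1 ^ k ** A2 ^ m\<close> is elliptic for large \<open>k\<close>, so the powers of \<open>W\<close> grow only like
  \<open>sqrt (det W) ^ j\<close>, and the terms of the series that belong to the powers of the word
  \<open>1 ^ k 2 ^ m\<close> alone force divergence as soon as \<open>sqrt (det A1) powr (s * (1 - q)) * p powr q > 1\<close>.
  At the unperturbed pair the products are larger, by explicit computation in (i) and by resistance
  in (ii), and the series still converges at some such \<open>s\<close>.

  In (ii) the exponent \<open>Q\<close> depends on the resistance constants. Countably many choices of these
  constants exhaust almost all of an open set of pairs, so one choice already gives a set of positive
  measure.\<close>

section \<open>Two by two matrices and their singular values\<close>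

text \<open>Since \<open>1 - q < 0\<close>, a small product gives a large term. The norm of a
  product is never below the square root of its absolute determinant, and the powers of an elliptic
  word attain this order. Norms alone control the series: \<open>phi s\<close> is at most the
  \<open>s\<close>-th power of the norm for every \<open>s > 0\<close>, which is what divergence
  needs, and equals it for \<open>s \<le> 1\<close>, which is what convergence needs. Keeping the
  exponents below 1 is the purpose of \<open>l < 1 / 2\<close> in (i) and of
  \<open>det A < 1/16\<close> in (ii). The power \<open>m\<close> is dictated by the size of the
  perturbation, so the letters 2 contribute an uncontrolled factor. It is fixed before
  \<open>k\<close> is chosen, and the \<open>k\<close>-th power of a number above 1, coming from the
  letter 1, absorbs it; hence only the weight of the letter 1 enters the divergence criterion. In
  (ii) resistance says nothing about words with many letters 2. For these only the determinant bound
  remains, so the letter 2 must have a small weight at the exponent in question. This is why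
  \<open>det A < (det B)\<^sup>2\<close> and a large \<open>q\<close> are imposed; the delicate
  point is uniformity as \<open>p\<close> tends to 1.\<close>

lemma trace_2: "trace (A :: 'a::semiring_1^2^2) = A$1$1 + A$2$2"
  by (simp add: trace_def UNIV_2)

lemma matrix_mult_2:
  fixes A B :: "'a::semiring_1^2^2"
  shows "(A ** B) $ i $ j = A$i$1 * B$1$j + A$i$2 * B$2$j"
  by (simp add: matrix_matrix_mult_def UNIV_2)

lemma matrix_vector_mult_2:
  fixes A :: "'a::semiring_1^2^2"
  shows "(A *v v) $ i = A$i$1 * v$1 + A$i$2 * v$2"
  by (simp add: matrix_vector_mult_def UNIV_2)

lemma mat_2:
  "(mat c :: 'a::zero^2^2)$1$1 = c" "(mat c :: 'a^2^2)$2$2 = c"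
  "(mat c :: 'a^2^2)$1$2 = 0" "(mat c :: 'a^2^2)$2$1 = 0"
  by (simp_all add: mat_def)

lemma mat2_eq_iff:
  "(A :: 'a^2^2) = B \<longleftrightarrow> A$1$1 = B$1$1 \<and> A$1$2 = B$1$2 \<and> A$2$1 = B$2$1 \<and> A$2$2 = B$2$2"
  by (auto simp: vec_eq_iff forall_2)

lemma norm_2_sq: "(norm (x :: real^2))\<^sup>2 = (x$1)\<^sup>2 + (x$2)\<^sup>2"
  by (simp add: norm_vec_def L2_set_def UNIV_2)

lemma eigenvalue_iff:
  fixes A :: "'a::field^2^2"
  shows "eigenvalue A z \<longleftrightarrow> z * z - trace A * z + det A = 0"
proof
  assume "eigenvalue A z"
  then obtain v where v: "v \<noteq> 0" "A *v v = z *s v"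
    by (auto simp: eigenvalue_def)
  have e1: "A$1$1 * v$1 + A$1$2 * v$2 = z * v$1" and e2: "A$2$1 * v$1 + A$2$2 * v$2 = z * v$2"
    using arg_cong[OF v(2), of "\<lambda>x. x$1"] arg_cong[OF v(2), of "\<lambda>x. x$2"]
    by (simp_all add: matrix_vector_mult_2)
  let ?f = "z * z - trace A * z + det A"
  have "?f * v$1 = 0" "?f * v$2 = 0"
  proof -
    \<comment> \<open>This is adj(z - A) (z - A) v = det(z - A) v, row by row.\<close>
    have "?f * v$1 = (z - A$2$2) * (z * v$1 - (A$1$1 * v$1 + A$1$2 * v$2))
        + A$1$2 * (z * v$2 - (A$2$1 * v$1 + A$2$2 * v$2))"
      "?f * v$2 = (z - A$1$1) * (z * v$2 - (A$2$1 * v$1 + A$2$2 * v$2))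
        + A$2$1 * (z * v$1 - (A$1$1 * v$1 + A$1$2 * v$2))"
      unfolding trace_2 det_2 by (simp_all add: algebra_simps)
    thus "?f * v$1 = 0" "?f * v$2 = 0" unfolding e1 e2 by simp_all
  qed
  moreover have "v$1 \<noteq> 0 \<or> v$2 \<noteq> 0"
    using v(1) by (auto simp: vec_eq_iff forall_2)
  ultimately show "?f = 0" by auto
next
  assume f: "z * z - trace A * z + det A = 0"
  hence f': "(A$1$1 - z) * (A$2$2 - z) = A$1$2 * A$2$1"
    unfolding trace_2 det_2 by (simp add: algebra_simps eq_neg_iff_add_eq_0)
  have ex: "eigenvalue A z" if "x \<noteq> 0 \<or> y \<noteq> 0" "A$1$1 * x + A$1$2 * y = z * x"
    "A$2$1 * x + A$2$2 * y = z * y" for x y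
    unfolding eigenvalue_def using that
    by (intro exI[of _ "vector [x, y]"])
       (auto simp: vec_eq_iff forall_2 matrix_vector_mult_2 vector_2)
  \<comment> \<open>The candidate eigenvectors are the columns of adj(z - A). If both vanish,
    \<open>A\<close> is scalar.\<close>
  consider "A$1$2 \<noteq> 0 \<or> z - A$1$1 \<noteq> 0" | "z - A$2$2 \<noteq> 0 \<or> A$2$1 \<noteq> 0"
    | "A$1$2 = 0" "z = A$1$1" "z = A$2$2" "A$2$1 = 0"
    using right_minus_eq[of z "A$1$1"] right_minus_eq[of z "A$2$2"] by argo
  thus "eigenvalue A z"
  proof cases
    case 1
    have "A$2$1 * A$1$2 + A$2$2 * (z - A$1$1) = z * (z - A$1$1)"
      using f' by (simp add: algebra_simps)
    thus ?thesis using 1 by (intro ex[of "A$1$2" "z - A$1$1"]) (auto simp: algebra_simps)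
  next
    case 2
    have "A$1$1 * (z - A$2$2) + A$1$2 * A$2$1 = z * (z - A$2$2)"
      using f' by (simp add: algebra_simps)
    thus ?thesis using 2 by (intro ex[of "z - A$2$2" "A$2$1"]) (auto simp: algebra_simps)
  next
    case 3
    thus ?thesis by (intro ex[of 1 0]) auto
  qed
qed

lemma opnorm_bound: "norm (A *v x) \<le> opnorm A * norm x"
  unfolding opnorm_def by (rule onorm) simp

lemma opnorm_nonneg: "0 \<le> opnorm A"
  unfolding opnorm_def by (rule onorm_pos_le) simp

lemma opnorm_le: "(\<And>x. norm (A *v x) \<le> b * norm x) \<Longrightarrow> opnorm A \<le> b"
  unfolding opnorm_def by (rule onorm_le)

lemma opnorm_mult: "opnorm (A ** B) \<le> opnorm A * opnorm B"
  unfolding opnorm_def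
proof -
  have "(*v) (A ** B) = (*v) A \<circ> (*v) B"
    by (auto simp: matrix_vector_mul_assoc)
  thus "onorm ((*v) (A ** B)) \<le> onorm ((*v) A) * onorm ((*v) B)"
    using onorm_compose[of "(*v) A" "(*v) B"] by (simp add: matrix_vector_mul_bounded_linear)
qed

lemma opnorm_one: "opnorm (mat 1) = 1"
proof -
  have "(*v) (mat 1 :: mat2) = (\<lambda>x. x)" by auto
  thus ?thesis by (simp add: opnorm_def onorm_id)
qed

lemma opnorm_scaleR: "opnorm (r *\<^sub>R A) = \<bar>r\<bar> * opnorm A"
proof -
  have "(*v) (r *\<^sub>R A) = (\<lambda>x. r *\<^sub>R (A *v x))"
    by (auto simp: scaleR_matrix_vector_assoc)
  thus ?thesis unfolding opnorm_def
    by (simp add: onorm_scaleR[OF matrix_vector_mul_bounded_linear])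
qed

lemma continuous_on_opnorm: "continuous_on S (opnorm :: mat2 \<Rightarrow> real)"
proof -
  have tri: "opnorm A \<le> opnorm B + opnorm (A - B)" for A B
  proof (rule opnorm_le)
    fix x
    have "norm (A *v x) \<le> norm (B *v x) + norm ((A - B) *v x)"
      using norm_triangle_ineq[of "B *v x" "(A - B) *v x"] by (simp add: matrix_vector_mult_diff_rdistrib)
    also have "\<dots> \<le> opnorm B * norm x + opnorm (A - B) * norm x"
      by (intro add_mono opnorm_bound)
    finally show "norm (A *v x) \<le> (opnorm B + opnorm (A - B)) * norm x"
      by (simp add: algebra_simps)
  qed
  \<comment> \<open>There are 4 entries, each bounded by \<open>norm A\<close>.\<close>
  have "opnorm A \<le> 4 * norm A" for A
    unfolding opnorm_def
  proof (rule onorm_le_matrix_component[where B = "norm A", THEN order_trans])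
    show "\<bar>A $ i $ j\<bar> \<le> norm A" for i j
      using order_trans[OF Finite_Cartesian_Product.norm_nth_le[of "A $ i" j]
          Finite_Cartesian_Product.norm_nth_le[of A i]] by simp
  qed auto
  hence 4: "opnorm A - opnorm B \<le> 4 * norm (A - B)" for A B
    using tri[of A B] by (smt (verit))
  show ?thesis
    unfolding continuous_on_iff dist_norm
  proof (intro ballI allI impI)
    fix A and e :: real assume e: "e > 0"
    have "norm (opnorm B - opnorm A) < e" if "norm (B - A) < e / 4" for B
      using 4[of A B] 4[of B A] that by (simp add: norm_minus_commute abs_less_iff)
    thus "\<exists>d>0. \<forall>B\<in>S. norm (B - A) < d \<longrightarrow> norm (opnorm B - opnorm A) < e"
      using e by (intro exI[of _ "e/4"]) auto
  qed
qed

lemma transpose_mult_self: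
  fixes A :: mat2
  shows "det (transpose A ** A) = (det A)\<^sup>2"
    and "trace (transpose A ** A) = (A$1$1)\<^sup>2 + (A$1$2)\<^sup>2 + (A$2$1)\<^sup>2 + (A$2$2)\<^sup>2"
  by (simp_all add: det_mul det_transpose trace_2 matrix_mult_2 power2_eq_square)
     (simp add: transpose_def)

text \<open>Two sums of squares show that the trace of the Gram matrix is at least twice
  \<open>\<bar>det A\<bar>\<close>, so its characteristic polynomial has two nonnegative real roots.
  The eigenvalue set is then explicit, and \<open>Max\<close> and \<open>Min\<close> can be
  evaluated even when the roots coincide.\<close>

lemma singular_values:
  fixes A :: mat2
  obtains t1 t2 where "sigma1 A = sqrt t1" "sigma2 A = sqrt t2" "0 \<le> t2" "t2 \<le> t1"
    "t1 * t2 = (det A)\<^sup>2" "eigenvalue (transpose A ** A) t1"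
    "t1 + t2 = trace (transpose A ** A)"
proof -
  define \<tau> where "\<tau> = trace (transpose A ** A)"
  define D where "D = \<bar>det A\<bar>"
  have tau: "\<tau> \<ge> 2 * D"
  proof -
    have "0 \<le> (A$1$1 - A$2$2)\<^sup>2 + (A$1$2 + A$2$1)\<^sup>2" "0 \<le> (A$1$1 + A$2$2)\<^sup>2 + (A$1$2 - A$2$1)\<^sup>2"
      by simp_all
    hence "\<tau> \<ge> 2 * det A" "\<tau> \<ge> - 2 * det A"
      unfolding \<tau>_def transpose_mult_self det_2 by (simp_all add: power2_eq_square algebra_simps)
    thus ?thesis unfolding D_def by linarith
  qed
  have D: "D \<ge> 0" by (simp add: D_def)
  define r where "r = sqrt (\<tau>\<^sup>2 - 4 * D\<^sup>2)"
  have "4 * D\<^sup>2 \<le> \<tau>\<^sup>2"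
    using power_mono[OF tau, of 2] D by (simp add: power_mult_distrib)
  hence r2: "r * r = \<tau>\<^sup>2 - 4 * D\<^sup>2" and r0: "r \<ge> 0" by (simp_all add: r_def)
  have r\<tau>: "r \<le> \<tau>"
    unfolding r_def using tau D by (intro real_le_lsqrt) auto
  define t1 t2 where "t1 = (\<tau> + r) / 2" and "t2 = (\<tau> - r) / 2"
  have prod: "t1 * t2 = D\<^sup>2" and sum: "t1 + t2 = \<tau>"
    using r2 by (simp_all add: t1_def t2_def field_simps power2_eq_square)
  have ev: "eigenvalue (transpose A ** A) t \<longleftrightarrow> t = t1 \<or> t = t2" for t
  proof -
    have "eigenvalue (transpose A ** A) t \<longleftrightarrow> t * t - (t1 + t2) * t + t1 * t2 = 0"
      unfolding eigenvalue_iff transpose_mult_self(1) prod sum \<tau>_def D_def by simp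
    also have "\<dots> \<longleftrightarrow> (t - t1) * (t - t2) = 0" by (simp add: algebra_simps)
    finally show ?thesis by simp
  qed
  hence set: "{t. eigenvalue (transpose A ** A) t} = {t1, t2}" by auto
  have le: "t2 \<le> t1" and nn: "0 \<le> t2" using r0 r\<tau> by (simp_all add: t1_def t2_def)
  show ?thesis
  proof (rule that[of t1 t2])
    show "sigma1 A = sqrt t1" "sigma2 A = sqrt t2"
      unfolding sigma1_def sigma2_def set using le by (auto simp: max_def min_def)
  qed (use le nn prod sum ev in \<open>auto simp: D_def \<tau>_def\<close>)
qed

lemma sigma_nonneg: "0 \<le> sigma2 A" "sigma2 A \<le> sigma1 A"
  and sigma_mult: "sigma1 A * sigma2 A = \<bar>det A\<bar>"
proof -
  obtain t1 t2 where t: "sigma1 A = sqrt t1" "sigma2 A = sqrt t2" "0 \<le> t2" "t2 \<le> t1"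
    "t1 * t2 = (det A)\<^sup>2" by (rule singular_values)
  thus "0 \<le> sigma2 A" "sigma2 A \<le> sigma1 A" by auto
  show "sigma1 A * sigma2 A = \<bar>det A\<bar>"
    using t by (metis real_sqrt_abs real_sqrt_mult)
qed

lemma norm_mult_vec_sq:
  fixes A :: mat2
  shows "(norm (A *v x))\<^sup>2 = x \<bullet> ((transpose A ** A) *v x)"
  by (simp add: norm_2_sq inner_vec_def UNIV_2 matrix_vector_mult_2 matrix_mult_2)
     (simp add: transpose_def power2_eq_square algebra_simps)

text \<open>An eigenvector for the larger root \<open>t1\<close> gives one inequality. The other one
  says that \<open>t1\<close> minus the Gram matrix \<open>S\<close> is positive
  semidefinite.\<close>

lemma sigma1_eq_opnorm: "sigma1 A = opnorm A"
proof -
  obtain t1 t2 where t: "sigma1 A = sqrt t1" "sigma2 A = sqrt t2" "0 \<le> t2" "t2 \<le> t1"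
    "t1 * t2 = (det A)\<^sup>2" "eigenvalue (transpose A ** A) t1"
    "t1 + t2 = trace (transpose A ** A)" by (rule singular_values)
  define S where "S = transpose A ** A"
  show ?thesis
  proof (rule antisym)
    from t(6) obtain v where v: "v \<noteq> 0" "S *v v = t1 *s v" by (auto simp: eigenvalue_def S_def)
    have "(norm (A *v v))\<^sup>2 = t1 * (norm v)\<^sup>2"
      using v(2) unfolding norm_mult_vec_sq S_def[symmetric]
      by (simp add: power2_norm_eq_inner scalar_mult_eq_scaleR)
    hence "sqrt ((norm (A *v v))\<^sup>2) = sqrt t1 * sqrt ((norm v)\<^sup>2)"
      by (simp only: real_sqrt_mult)
    hence "norm (A *v v) = sigma1 A * norm v" by (simp add: t(1))
    thus "sigma1 A \<le> opnorm A"
      using opnorm_bound[of A v] v(1) by simp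
  next
    have sym: "S$1$2 = S$2$1" by (simp add: S_def matrix_mult_2 transpose_def mult.commute)
    have tr: "t1 + t2 = S$1$1 + S$2$2" using t(7) by (simp add: S_def trace_2)
    have dt: "t1 * t2 = S$1$1 * S$2$2 - S$1$2 * S$1$2"
      using t(5) sym transpose_mult_self(1)[of A] unfolding S_def[symmetric] det_2[of S] by simp
    show "opnorm A \<le> sigma1 A"
    proof (rule opnorm_le)
      fix x :: "real^2"
      define a b where "a = t1 - S$1$1" and "b = t1 - S$2$2"
      have sum: "a + b = t1 - t2" using tr by (simp add: a_def b_def)
      have "a * b = t1 * t1 - t1 * (S$1$1 + S$2$2) + S$1$1 * S$2$2"
        by (simp add: a_def b_def algebra_simps)
      also have "\<dots> = S$1$2 * S$1$2" unfolding tr[symmetric] using dt by (simp add: algebra_simps)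
      finally have ab: "a * b = S$1$2 * S$1$2" "a + b = t1 - t2" using sum by auto
      \<comment> \<open>The symmetric matrix M = \<open>t1\<close> - S is singular with trace
        \<open>a + b\<close>, so Cayley-Hamilton gives tr(M) M = M M, that is, tr(M) times the
        quadratic form at x is the squared norm of M x.\<close>
      have "(a + b) * (a * (x$1)\<^sup>2 - 2 * S$1$2 * x$1 * x$2 + b * (x$2)\<^sup>2)
          = (a * x$1 - S$1$2 * x$2)\<^sup>2 + (S$1$2 * x$1 - b * x$2)\<^sup>2"
        using arg_cong[OF ab(1), of "\<lambda>z. z * ((x$1)\<^sup>2 + (x$2)\<^sup>2)"]
        by (simp add: power2_eq_square algebra_simps)
      hence nn: "(a + b) * (a * (x$1)\<^sup>2 - 2 * S$1$2 * x$1 * x$2 + b * (x$2)\<^sup>2) \<ge> 0" by simp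
      have "a * (x$1)\<^sup>2 - 2 * S$1$2 * x$1 * x$2 + b * (x$2)\<^sup>2 \<ge> 0"
      proof (cases "a + b = 0")
        case True
        hence b: "b = - a" by simp
        have "a * a + S$1$2 * S$1$2 = 0" using ab(1) unfolding b by linarith
        hence "a = 0 \<and> S$1$2 = 0" using sum_squares_eq_zero_iff[of a "S$1$2"] by simp
        hence "a = 0" "S$1$2 = 0" by simp_all
        with True show ?thesis by simp
      next
        case False
        hence "a + b > 0" using ab(2) t(4) by simp
        with nn show ?thesis by (simp add: zero_le_mult_iff)
      qed
      hence "x \<bullet> (S *v x) \<le> t1 * (norm x)\<^sup>2"
        unfolding norm_2_sq a_def b_def using sym
        by (simp add: inner_vec_def UNIV_2 matrix_vector_mult_2 algebra_simps power2_eq_square)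
      hence "(norm (A *v x))\<^sup>2 \<le> t1 * (norm x)\<^sup>2" by (simp add: norm_mult_vec_sq S_def)
      hence "sqrt ((norm (A *v x))\<^sup>2) \<le> sqrt t1 * sqrt ((norm x)\<^sup>2)"
        by (simp only: real_sqrt_mult[symmetric] real_sqrt_le_mono)
      thus "norm (A *v x) \<le> sigma1 A * norm x" by (simp add: t(1))
    qed
  qed
qed

text \<open>In all three regimes \<open>sigma2\<close> is replaced by the larger
  \<open>sigma1\<close>. After raising to the power \<open>1 - q\<close> this bounds terms of the
  series from below, whatever the size of \<open>s\<close>.\<close>

lemma phi_le_opnorm_powr:
  assumes "det A \<noteq> 0" "s > 0"
  shows "phi s A \<le> opnorm A powr s"
proof -
  have pos: "0 < sigma2 A" "0 < sigma1 A"
    using sigma_nonneg[of A] sigma_mult[of A] assms by (auto simp: less_le)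
  consider "s \<le> 1" | "1 < s" "s \<le> 2" | "2 < s" by linarith
  thus ?thesis
  proof cases
    case 1
    thus ?thesis by (simp add: phi_def sigma1_eq_opnorm)
  next
    case 2
    have "sigma1 A * sigma2 A powr (s - 1) \<le> sigma1 A * sigma1 A powr (s - 1)"
      using 2 sigma_nonneg[of A] pos by (intro mult_left_mono powr_mono2) auto
    also have "\<dots> = sigma1 A powr s"
      using pos powr_mult_base[of "sigma1 A" "s - 1"] by simp
    finally show ?thesis using 2 by (simp add: phi_def sigma1_eq_opnorm)
  next
    case 3
    have "\<bar>det A\<bar> \<le> sigma1 A * sigma1 A"
      unfolding sigma_mult[symmetric] using sigma_nonneg[of A] pos by (intro mult_left_mono) auto
    also have "\<dots> = sigma1 A powr 2" using pos by (simp add: power2_eq_square)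
    finally have "\<bar>det A\<bar> powr (s / 2) \<le> (sigma1 A powr 2) powr (s / 2)"
      using 3 by (intro powr_mono2) auto
    thus ?thesis using 3 by (simp add: phi_def powr_powr sigma1_eq_opnorm)
  qed
qed

lemma phi_eq_opnorm_powr: "s \<le> 1 \<Longrightarrow> phi s A = opnorm A powr s"
  by (simp add: phi_def sigma1_eq_opnorm)

lemma phi_pos: "det A \<noteq> 0 \<Longrightarrow> 0 < phi s A"
proof -
  assume "det A \<noteq> 0"
  hence "0 < sigma2 A" "0 < sigma1 A"
    using sigma_nonneg[of A] sigma_mult[of A] by (auto simp: less_le)
  thus ?thesis using \<open>det A \<noteq> 0\<close> by (simp add: phi_def)
qed

lemma abs_det_le_opnorm: "\<bar>det A\<bar> \<le> (opnorm A)\<^sup>2" for A :: mat2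
  unfolding sigma_mult[symmetric] sigma1_eq_opnorm[symmetric]
  using sigma_nonneg[of A] by (auto simp: power2_eq_square intro!: mult_left_mono)

section \<open>Sums over words\<close>

lemma word_prod_Nil [simp]: "word_prod A1 A2 [] = mat 1"
  by (simp add: word_prod_def)

lemma word_prod_Cons [simp]:
  "word_prod A1 A2 (i # w) = (if i = 1 then A1 else A2) ** word_prod A1 A2 w"
  by (simp add: word_prod_def)

lemma word_prod_append: "word_prod A1 A2 (u @ v) = word_prod A1 A2 u ** word_prod A1 A2 v"
  by (induction u) (simp_all add: matrix_mul_assoc)

primrec mpow :: "mat2 \<Rightarrow> nat \<Rightarrow> mat2" where
  "mpow A 0 = mat 1"
| "mpow A (Suc n) = A ** mpow A n"

lemma word_prod_concat_replicate:
  "word_prod A1 A2 (concat (replicate j u)) = mpow (word_prod A1 A2 u) j"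
  by (induction j) (simp_all add: word_prod_append)

lemma word_prod_replicate:
  "word_prod A1 A2 (replicate k i) = mpow (if i = 1 then A1 else A2) k"
  by (induction k) simp_all

lemma det_mpow: "det (mpow A k) = det A ^ k"
  by (induction k) (simp_all add: det_mul)

lemma opnorm_mpow: "opnorm (mpow A k) \<le> opnorm A ^ k"
proof (induction k)
  case (Suc k)
  have "opnorm (mpow A (Suc k)) \<le> opnorm A * opnorm (mpow A k)" by (simp add: opnorm_mult)
  also have "\<dots> \<le> opnorm A * opnorm A ^ k" by (intro mult_left_mono Suc opnorm_nonneg)
  finally show ?case by simp
qed (simp add: opnorm_one)

lemma word_weight_Nil [simp]: "word_weight q p [] = 1"
  by (simp add: word_weight_def)

lemma word_weight_Cons [simp]:
  "word_weight q p (i # w) = (if i = 1 then p else 1 - p) powr q * word_weight q p w"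
  by (simp add: word_weight_def)

lemma word_weight_append: "word_weight q p (u @ v) = word_weight q p u * word_weight q p v"
  by (simp add: word_weight_def)

lemma word_weight_concat_replicate:
  "word_weight q p (concat (replicate j u)) = word_weight q p u ^ j"
  by (induction j) (simp_all add: word_weight_append)

lemma word_weight_replicate:
  "word_weight q p (replicate k i) = ((if i = 1 then p else 1 - p) powr q) ^ k"
  by (induction k) simp_all

lemma word_weight_nonneg: "0 \<le> word_weight q p w"
  by (induction w) simp_all

lemma words_0: "words 0 = {[]}"
  by (auto simp: words_def)

lemma words_Suc: "words (Suc n) = (#) 1 ` words n \<union> (#) 2 ` words n"
  by (auto simp: words_def length_Suc_conv)

lemma finite_words: "finite (words n)"
  by (induction n) (simp_all add: words_0 words_Suc)

lemma sum_words_Suc: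
  fixes F :: "nat list \<Rightarrow> real"
  shows "(\<Sum>w\<in>words (Suc n). F w) = (\<Sum>w\<in>words n. F (1 # w)) + (\<Sum>w\<in>words n. F (2 # w))"
  unfolding words_Suc
  by (subst sum.union_disjoint) (auto simp: finite_words sum.reindex)

text \<open>The convergence proofs bound each term by a product over the letters of the word, which
  turns the sum over words of length \<open>n\<close> into an \<open>n\<close>-th power.\<close>

lemma sum_words_prod_list:
  fixes g :: "nat \<Rightarrow> real"
  shows "(\<Sum>w\<in>words n. prod_list (map g w)) = (g 1 + g 2) ^ n"
  by (induction n) (simp_all add: words_0 sum_words_Suc sum_distrib_left[symmetric] distrib_right)

lemma prod_list_map_mult:
  fixes f g :: "'a \<Rightarrow> real"
  shows "prod_list (map f w) * prod_list (map g w) = prod_list (map (\<lambda>i. f i * g i) w)"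
  by (induction w) simp_all

lemma prod_list_map_pos:
  fixes f :: "'a \<Rightarrow> real"
  shows "(\<And>i. 0 < f i) \<Longrightarrow> 0 < prod_list (map f w)"
  by (induction w) simp_all

lemma prod_list_map_powr:
  fixes f :: "'a \<Rightarrow> real"
  shows "(\<And>i. 0 < f i) \<Longrightarrow> prod_list (map f w) powr a = prod_list (map (\<lambda>i. f i powr a) w)"
  by (induction w) (simp_all add: powr_mult prod_list_map_pos less_imp_le)

lemma det_word_prod:
  "det (word_prod A1 A2 w) = prod_list (map (\<lambda>i. if i = 1 then det A1 else det A2) w)"
  by (induction w) (simp_all add: det_mul)

lemma opnorm_word_prod_le_1:
  assumes "opnorm A1 \<le> 1" "opnorm A2 \<le> 1"
  shows "opnorm (word_prod A1 A2 w) \<le> 1"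
proof (induction w)
  case (Cons i w)
  have "opnorm (word_prod A1 A2 (i # w)) \<le> opnorm (if i = 1 then A1 else A2) * opnorm (word_prod A1 A2 w)"
    by (simp add: opnorm_mult)
  also have "\<dots> \<le> 1" using assms Cons by (intro mult_le_one opnorm_nonneg) auto
  finally show ?case .
qed (simp add: opnorm_one)

lemma opnorm_pos: "det A \<noteq> 0 \<Longrightarrow> 0 < opnorm A"
  using abs_det_le_opnorm[of A] opnorm_nonneg[of A] by (cases "opnorm A = 0") auto

lemma power_powr_swap: "0 < x \<Longrightarrow> (x ^ n) powr a = (x powr a) ^ n" for x :: real
  by (induction n) (simp_all add: powr_mult)

section \<open>Criteria for convergence and divergence, and bounds for \<open>r_dim\<close>\<close>

definition word_sum :: "real \<Rightarrow> mat2 \<Rightarrow> mat2 \<Rightarrow> real \<Rightarrow> real \<Rightarrow> nat \<Rightarrow> real" where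
  "word_sum q A1 A2 p s n =
    (\<Sum>w\<in>words n. phi s (word_prod A1 A2 w) powr (1 - q) * word_weight q p w)"

lemma r_dim_eq: "r_dim q A1 A2 p = Sup {s. s > 0 \<and> summable (\<lambda>n. word_sum q A1 A2 p s (Suc n))}"
  by (simp add: r_dim_def word_sum_def)

lemma word_sum_nonneg: "0 \<le> word_sum q A1 A2 p s n"
  unfolding word_sum_def by (intro sum_nonneg mult_nonneg_nonneg word_weight_nonneg) simp

text \<open>Two geometric terms are allowed because the estimate for resistant pairs treats words
  with few and with many letters 2 separately.\<close>

lemma summable_word_sum:
  assumes "\<And>n. word_sum q A1 A2 p s n \<le> a * x ^ n + b * y ^ n"
    and "0 \<le> x" "x < 1" "0 \<le> y" "y < 1"
  shows "summable (\<lambda>n. word_sum q A1 A2 p s (Suc n))"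
proof -
  have "summable (\<lambda>n. a * x ^ n + b * y ^ n)"
    using assms by (intro summable_add summable_mult summable_geometric) auto
  hence "summable (word_sum q A1 A2 p s)"
    by (rule summable_comparison_test') (simp add: assms(1) word_sum_nonneg)
  thus ?thesis by (simp only: summable_Suc_iff)
qed

text \<open>Only the powers of the word \<open>u\<close> are kept. By \<open>ge1\<close> their terms
  stay above \<open>C powr (s * (1 - q))\<close>, so the terms of the series do not tend to 0. As
  all products have norm at most 1, divergence at \<open>s\<close> carries over to every larger
  exponent.\<close>

lemma not_summable_word_sum:
  assumes q: "q > 1" and det: "det A1 \<noteq> 0" "det A2 \<noteq> 0"
    and norm: "opnorm A1 \<le> 1" "opnorm A2 \<le> 1" and s: "0 < s" "s \<le> s'"
    and u: "u \<in> words L" "L \<ge> 1"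
    and C: "C > 0" "\<rho> > 0" "\<And>j. opnorm (mpow (word_prod A1 A2 u) j) \<le> C * \<rho> ^ j"
    and ge1: "1 \<le> \<rho> powr (s * (1 - q)) * word_weight q p u"
  shows "\<not> summable (\<lambda>n. word_sum q A1 A2 p s' (Suc n))"
proof
  assume "summable (\<lambda>n. word_sum q A1 A2 p s' (Suc n))"
  hence "(\<lambda>n. word_sum q A1 A2 p s' (Suc n)) \<longlonglongrightarrow> 0" by (rule summable_LIMSEQ_zero)
  moreover have "C powr (s * (1 - q)) > 0" using C by simp
  ultimately have "\<forall>\<^sub>F n in sequentially. word_sum q A1 A2 p s' (Suc n) < C powr (s * (1 - q))"
    by (rule order_tendstoD)
  then obtain N where N: "\<And>n. n \<ge> N \<Longrightarrow> word_sum q A1 A2 p s' (Suc n) < C powr (s * (1 - q))"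
    by (auto simp: eventually_sequentially)
  \<comment> \<open>The series starts with words of length 1, so words of length
    \<open>j * L\<close> belong to the index \<open>j * L - 1\<close>, which has to be at least
    \<open>N\<close>.\<close>
  define j where "j = Suc N"
  define w where "w = concat (replicate j u)"
  have "length w = j * L" "set w \<subseteq> {1, 2}"
    using u by (auto simp: w_def words_def length_concat map_replicate sum_list_replicate)
  moreover have jL: "Suc N \<le> j * L" using mult_le_mono2[OF u(2), of j] by (simp add: j_def)
  moreover obtain n where n: "j * L = Suc n" using jL by (cases "j * L") auto
  ultimately have w: "w \<in> words (Suc n)" by (simp add: words_def)
  define A where "A = word_prod A1 A2 w"
  have A: "A = mpow (word_prod A1 A2 u) j"
    by (simp add: A_def w_def word_prod_concat_replicate)
  have "det A \<noteq> 0" using det by (auto simp: A_def det_word_prod prod_list_zero_iff)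
  have "phi s' A \<le> opnorm A powr s'"
    using \<open>det A \<noteq> 0\<close> s by (intro phi_le_opnorm_powr) auto
  also have "\<dots> \<le> opnorm A powr s"
    using s norm by (intro powr_mono') (auto simp: A_def opnorm_word_prod_le_1 opnorm_nonneg)
  also have "\<dots> \<le> (C * \<rho> ^ j) powr s"
    unfolding A using C(3) s by (intro powr_mono2 opnorm_nonneg) auto
  finally have "((C * \<rho> ^ j) powr s) powr (1 - q) \<le> phi s' A powr (1 - q)"
    using q phi_pos[OF \<open>det A \<noteq> 0\<close>] by (intro powr_mono2') auto
  moreover have "((C * \<rho> ^ j) powr s) powr (1 - q) = C powr (s * (1 - q)) * (\<rho> powr (s * (1 - q))) ^ j"
    using C(1,2) by (simp add: powr_powr powr_mult power_powr_swap)
  moreover have "word_weight q p w = word_weight q p u ^ j"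
    by (simp add: w_def word_weight_concat_replicate)
  ultimately have "C powr (s * (1 - q)) * (\<rho> powr (s * (1 - q))) ^ j * word_weight q p u ^ j
      \<le> phi s' A powr (1 - q) * word_weight q p w"
    by (simp add: mult_right_mono word_weight_nonneg)
  also have "\<dots> \<le> word_sum q A1 A2 p s' (Suc n)"
    unfolding word_sum_def A_def
    by (rule member_le_sum[OF w]) (auto simp: finite_words word_weight_nonneg)
  also have "\<dots> < C powr (s * (1 - q))" using N n jL by simp
  finally have "C powr (s * (1 - q)) * (\<rho> powr (s * (1 - q)) * word_weight q p u) ^ j < C powr (s * (1 - q))"
    by (simp add: power_mult_distrib mult_ac)
  moreover have "1 \<le> (\<rho> powr (s * (1 - q)) * word_weight q p u) ^ j"
    by (rule one_le_power[OF ge1])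
  ultimately show False
    using mult_left_mono[of 1 _ "C powr (s * (1 - q))"] by force
qed

lemma powr_less_self: "0 < (p::real) \<Longrightarrow> p < 1 \<Longrightarrow> q > 1 \<Longrightarrow> p powr q < p"
  using powr_less_mono'[of p 1 q] by simp

text \<open>The determinant bound for the norm gives a geometric ratio \<open>f s\<close> with
  \<open>f 0 = p powr q + (1 - p) powr q < 1\<close>, and continuity keeps it below 1 for small
  \<open>s\<close>. This makes the set in \<open>r_dim\<close> nonempty, as a bound on a real
  supremum requires.\<close>

lemma summable_word_sum_small:
  assumes q: "q > 1" and p: "0 < p" "p < 1" and det: "det A1 \<noteq> 0" "det A2 \<noteq> 0"
  obtains s where "s > 0" "summable (\<lambda>n. word_sum q A1 A2 p s (Suc n))"
proof -
  define d where "d i = \<bar>if i = (1::nat) then det A1 else det A2\<bar>" for i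
  have d: "d i > 0" for i using det by (simp add: d_def)
  define f where "f s = d 1 powr (s / 2 * (1 - q)) * p powr q
    + d 2 powr (s / 2 * (1 - q)) * (1 - p) powr q" for s
  have d0: "d i \<noteq> 0" for i using d[of i] by simp
  have "isCont f 0"
    unfolding f_def using d[of 1] d[of 2] by (intro continuous_intros) simp_all
  hence "(f \<longlongrightarrow> f 0) (at_right 0)" unfolding isCont_def by (rule filterlim_at_split[THEN iffD1, THEN conjunct2])
  moreover have "f 0 = p powr q + (1 - p) powr q" by (simp add: f_def d0)
  hence "f 0 < 1" using powr_less_self[of p q] powr_less_self[of "1 - p" q] p q by linarith
  ultimately have "\<forall>\<^sub>F s in at_right 0. f s < 1" by (rule order_tendstoD)
  moreover have "\<forall>\<^sub>F s in at_right (0::real). s \<in> {0<..<1}"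
    by (rule eventually_at_right_real) simp
  ultimately have "\<forall>\<^sub>F s in at_right (0::real). f s < 1 \<and> s \<in> {0<..<1}" by (rule eventually_conj)
  then obtain s where s: "f s < 1" "0 < s" "s < 1"
    using eventually_happens'[OF trivial_limit_at_right_real] by auto
  show ?thesis
  proof (rule that)
    show "summable (\<lambda>n. word_sum q A1 A2 p s (Suc n))"
    proof (rule summable_word_sum)
      fix n
      have "phi s (word_prod A1 A2 w) powr (1 - q) * word_weight q p w
          \<le> prod_list (map (\<lambda>i. d i powr (s / 2 * (1 - q)) * (if i = 1 then p else 1 - p) powr q) w)"
        for w
      proof -
        let ?A = "word_prod A1 A2 w"
        have absd: "\<bar>det ?A\<bar> = prod_list (map d w)"
          unfolding det_word_prod d_def by (induction w) (simp_all add: abs_mult)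
        have "\<bar>det ?A\<bar> powr (s / 2) \<le> ((opnorm ?A)\<^sup>2) powr (s / 2)"
          using s by (intro powr_mono2 abs_det_le_opnorm) auto
        also have "\<dots> = phi s ?A"
          using s opnorm_nonneg[of ?A] by (simp add: phi_eq_opnorm_powr powr_powr flip: powr_numeral)
        finally have "phi s ?A powr (1 - q) \<le> (\<bar>det ?A\<bar> powr (s / 2)) powr (1 - q)"
          using q prod_list_map_pos[of d w] d by (intro powr_mono2') (auto simp: absd)
        also have "\<dots> = prod_list (map (\<lambda>i. d i powr (s / 2 * (1 - q))) w)"
          unfolding absd powr_powr by (intro prod_list_map_powr d)
        finally show ?thesis
          unfolding prod_list_map_mult[symmetric] word_weight_def[symmetric]
          by (rule mult_right_mono) (rule word_weight_nonneg)
      qed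
      hence "word_sum q A1 A2 p s n \<le> (\<Sum>w\<in>words n.
          prod_list (map (\<lambda>i. d i powr (s / 2 * (1 - q)) * (if i = 1 then p else 1 - p) powr q) w))"
        unfolding word_sum_def by (intro sum_mono)
      also have "\<dots> = f s ^ n" unfolding sum_words_prod_list f_def by simp
      finally show "word_sum q A1 A2 p s n \<le> 1 * f s ^ n + 0 * 0 ^ n" by simp
    qed (use s in \<open>auto simp: f_def\<close>)
  qed (use s in auto)
qed

lemma r_dim_le:
  assumes q: "q > 1" and p: "0 < p" "p < 1" and det: "det A1 \<noteq> 0" "det A2 \<noteq> 0"
    and div: "\<And>s'. s \<le> s' \<Longrightarrow> \<not> summable (\<lambda>n. word_sum q A1 A2 p s' (Suc n))"
  shows "r_dim q A1 A2 p \<le> s"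
proof -
  obtain s0 where "s0 > 0" "summable (\<lambda>n. word_sum q A1 A2 p s0 (Suc n))"
    by (rule summable_word_sum_small[OF q p det])
  thus ?thesis
    unfolding r_dim_eq
  proof (intro cSup_least)
    fix s' assume "s' \<in> {s. s > 0 \<and> summable (\<lambda>n. word_sum q A1 A2 p s (Suc n))}"
    thus "s' \<le> s" using div[of s'] by (cases "s \<le> s'") auto
  qed auto
qed

text \<open>The real supremum dominates its members only if the set is bounded above; the bound
  comes from the powers of the one-letter word \<open>[1]\<close>.\<close>

lemma r_dim_ge:
  assumes q: "q > 1" and p: "0 < p" "p < 1" and det: "det A1 \<noteq> 0" "det A2 \<noteq> 0"
    and norm: "opnorm A1 < 1" "opnorm A2 < 1"
    and s: "0 < s" "summable (\<lambda>n. word_sum q A1 A2 p s (Suc n))"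
  shows "s \<le> r_dim q A1 A2 p"
proof -
  define \<rho> where "\<rho> = opnorm A1"
  have \<rho>: "0 < \<rho>" "\<rho> < 1" using opnorm_pos det norm by (auto simp: \<rho>_def)
  \<comment> \<open>The solution of \<open>\<rho> powr (S * (1 - q)) * p powr q = 1\<close>.\<close>
  define S where "S = q * ln p / ((q - 1) * ln \<rho>)"
  have "q * ln p < 0" "(q - 1) * ln \<rho> < 0" using p q \<rho> by (simp_all add: mult_less_0_iff)
  hence S: "S > 0" by (simp add: S_def divide_neg_neg)
  have "S * (1 - q) * ln \<rho> = - q * ln p"
    using q \<rho> by (simp add: S_def field_simps)
  hence "\<rho> powr (S * (1 - q)) * p powr q = 1"
    using \<rho> p by (simp add: powr_def flip: exp_add)
  hence "\<not> summable (\<lambda>n. word_sum q A1 A2 p s' (Suc n))" if "S \<le> s'" for s'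
    using norm \<rho>
    by (intro not_summable_word_sum[OF q det _ _ S that, where u = "[1]" and L = 1 and C = 1 and \<rho> = \<rho>])
       (auto simp: words_def \<rho>_def opnorm_mpow)
  hence "bdd_above {s. s > 0 \<and> summable (\<lambda>n. word_sum q A1 A2 p s (Suc n))}"
    by (intro bdd_aboveI[of _ S]) (metis (no_types, lifting) linear mem_Collect_eq)
  thus ?thesis unfolding r_dim_eq using s by (intro cSup_upper) auto
qed

section \<open>Discontinuity by rotating the second matrix\<close>

text \<open>An elliptic matrix scales a definite quadratic form by its determinant; comparing this
  form with the Euclidean one costs a constant that does not depend on \<open>j\<close>.\<close>

lemma mpow_opnorm_bound:
  fixes W :: mat2
  assumes ell: "(trace W)\<^sup>2 < 4 * det W"
  obtains C where "C > 0" "\<And>j. opnorm (mpow W j) \<le> C * sqrt (det W) ^ j"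
proof -
  define m where "m = (W$2$2 - W$1$1) / 2"
  define k where "k = - W$1$2 * W$2$1 - m\<^sup>2"
  have k: "k > 0"
    using ell by (simp add: k_def m_def trace_2 det_2 power2_eq_square field_simps)
  \<comment> \<open>up to a constant, \<open>F v\<close> is the area form of \<open>v\<close> and \<open>W *v v\<close>, which \<open>W\<close> scales by \<open>det W\<close>\<close>
  define F where "F v = (W$2$1 - W$1$2) * (v$1 * (W *v v)$2 - v$2 * (W *v v)$1)" for v :: "real^2"
  \<comment> \<open>Let M be the symmetric matrix with diagonal \<open>W$2$1\<close>,
    \<open>- W$1$2\<close> and off-diagonal entry \<open>m\<close>. Then F is tr(M) times the form
    of M, which by Cayley-Hamilton equals the squared norm of M v plus det(M) times that of v. Here
    \<open>k\<close> is det(M), a quarter of \<open>4 * det W - (trace W)\<^sup>2\<close>. The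
    factor tr(M) makes the sign of the area form irrelevant.\<close>
  have F_eq: "F v = (W$2$1 * v$1 + m * v$2)\<^sup>2 + (m * v$1 - W$1$2 * v$2)\<^sup>2 + k * (norm v)\<^sup>2" for v
    unfolding F_def norm_2_sq
    by (simp add: matrix_vector_mult_2 k_def m_def power2_eq_square field_simps)
  have F_W: "F (W *v v) = det W * F v" for v
    by (simp add: F_def matrix_vector_mult_2 det_2 power2_eq_square algebra_simps)
  have F_pow: "F (mpow W j *v v) = det W ^ j * F v" for j v
    by (induction j) (simp_all add: F_W flip: matrix_vector_mul_assoc)
  have det: "det W > 0" using ell by (smt (verit) zero_le_power2)
  have cs: "(a * x + b * y)\<^sup>2 \<le> (a\<^sup>2 + b\<^sup>2) * (x\<^sup>2 + y\<^sup>2)" for a b x y :: real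
  proof -
    have "(a\<^sup>2 + b\<^sup>2) * (x\<^sup>2 + y\<^sup>2) - (a * x + b * y)\<^sup>2 = (a * y - b * x)\<^sup>2"
      by (simp add: power2_eq_square algebra_simps)
    thus ?thesis by (metis diff_ge_0_iff_ge zero_le_power2)
  qed
  define K where "K = (W$2$1)\<^sup>2 + m\<^sup>2 + (m\<^sup>2 + (W$1$2)\<^sup>2) + k"
  have K: "K > 0" using k by (simp add: K_def add_nonneg_pos)
  have F_le: "F v \<le> K * (norm v)\<^sup>2" for v
    using cs[of "W$2$1" "v$1" m "v$2"] cs[of m "v$1" "- W$1$2" "v$2"]
    unfolding F_eq K_def norm_2_sq by (simp add: distrib_right)
  show ?thesis
  proof (rule that[of "sqrt (K / k)"])
    fix j
    show "opnorm (mpow W j) \<le> sqrt (K / k) * sqrt (det W) ^ j"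
    proof (rule opnorm_le)
      fix v
      have "k * (norm (mpow W j *v v))\<^sup>2 \<le> F (mpow W j *v v)" by (simp add: F_eq)
      also have "\<dots> \<le> det W ^ j * (K * (norm v)\<^sup>2)"
        unfolding F_pow using det F_le by (intro mult_left_mono) auto
      finally have "(norm (mpow W j *v v))\<^sup>2 \<le> K / k * det W ^ j * (norm v)\<^sup>2"
        using k by (simp add: field_simps)
      hence "sqrt ((norm (mpow W j *v v))\<^sup>2) \<le> sqrt (K / k * det W ^ j * (norm v)\<^sup>2)"
        by (rule real_sqrt_le_mono)
      thus "norm (mpow W j *v v) \<le> sqrt (K / k) * sqrt (det W) ^ j * norm v"
        by (simp only: real_sqrt_mult real_sqrt_power[of "det W" j] real_sqrt_abs abs_norm_cancel)
    qed
  qed (use k K in simp)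
qed

lemma Cayley_Hamilton_2: "A ** A = trace A *\<^sub>R A - det A *\<^sub>R (mat 1)" for A :: mat2
  by (simp add: mat2_eq_iff matrix_mult_2 trace_2 det_2 mat_2 algebra_simps)

lemma trace_scaleR: "trace (r *\<^sub>R A) = r * trace A" for A :: mat2
  by (simp add: trace_2 distrib_left)

lemma det_scaleR_2: "det (r *\<^sub>R A) = r\<^sup>2 * det A" for A :: mat2
  by (simp add: det_2 power2_eq_square algebra_simps)

text \<open>By Cayley-Hamilton the traces satisfy a linear recurrence with characteristic roots
  \<open>h1\<close> and \<open>h2\<close>; the hypothesis on \<open>M\<close> removes the
  \<open>h1\<close> component. With \<open>h2 < h1\<close> the trace then becomes small against the
  square root of the determinant.\<close>

lemma trace_mpow_mult:
  fixes A M :: mat2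
  assumes h: "h1 + h2 = trace A" "h1 * h2 = det A" and M: "trace (A ** M) = h2 * trace M"
  shows "trace (mpow A k ** M) = h2 ^ k * trace M"
proof (induction k rule: induct_nat_012)
  case (ge2 n)
  have "mpow A (Suc (Suc n)) ** M = (A ** A) ** (mpow A n ** M)"
    by (simp add: matrix_mul_assoc)
  also have "\<dots> = trace A *\<^sub>R (mpow A (Suc n) ** M) - det A *\<^sub>R (mpow A n ** M)"
    unfolding Cayley_Hamilton_2[of A]
    by (simp add: mat2_eq_iff matrix_mult_2 mat_2 algebra_simps)
  finally have "trace (mpow A (Suc (Suc n)) ** M)
      = (h1 + h2) * (h2 ^ Suc n * trace M) - h1 * h2 * (h2 ^ n * trace M)"
    by (simp only: trace_sub trace_scaleR ge2 h)
  thus ?case by (simp add: algebra_simps)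
qed (use M in simp_all)

text \<open>For \<open>trace J = 0\<close> and \<open>det J = 1\<close> the square of
  \<open>J\<close> is minus the identity, so this is the exponential of \<open>t\<close> times
  \<open>J\<close>: a one-parameter group conjugate to the rotations, written without a change of
  basis.\<close>

definition rot :: "mat2 \<Rightarrow> real \<Rightarrow> mat2" where
  "rot J t = cos t *\<^sub>R mat 1 + sin t *\<^sub>R J"

context
  fixes J :: mat2
  assumes J: "trace J = 0" "det J = 1"
begin

lemma J_entry: "J$2$2 = - J$1$1"
  using J(1) by (simp add: trace_2 eq_neg_iff_add_eq_0 add.commute)

lemma rot_add: "rot J s ** rot J t = rot J (s + t)"
proof -
  have "rot J s ** rot J t = (cos s * cos t) *\<^sub>R mat 1 + (cos s * sin t + sin s * cos t) *\<^sub>R J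
      + (sin s * sin t) *\<^sub>R (J ** J)"
    by (simp add: rot_def mat2_eq_iff matrix_mult_2 mat_2 algebra_simps)
  also have "J ** J = - (mat 1)" using Cayley_Hamilton_2[of J] J by simp
  finally show ?thesis by (simp add: rot_def cos_add sin_add algebra_simps)
qed

lemma mpow_rot: "mpow (b *\<^sub>R rot J t) m = b ^ m *\<^sub>R rot J (real m * t)"
proof (induction m)
  case (Suc m)
  have "mpow (b *\<^sub>R rot J t) (Suc m) = b ^ Suc m *\<^sub>R (rot J t ** rot J (real m * t))"
    by (simp add: Suc mat2_eq_iff matrix_mult_2 algebra_simps)
  thus ?case by (simp add: rot_add algebra_simps)
qed (simp add: rot_def)

lemma det_rot: "det (rot J t) = 1"
proof -
  have "det (rot J t) = (cos t)\<^sup>2 + cos t * sin t * trace J + (sin t)\<^sup>2 * det J"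
    by (simp add: rot_def det_2 trace_2 mat_2 power2_eq_square algebra_simps)
  thus ?thesis using J by simp
qed

text \<open>The hypothesis \<open>aligned\<close> says that \<open>B ^ m\<close> maps the expanding eigenline of \<open>A\<close> onto the
  contracting one, so that \<open>A ^ k ** B ^ m\<close> is elliptic for large \<open>k\<close>.\<close>

lemma r_dim_le_aligned:
  fixes A :: mat2
  assumes q: "q > 1" and p: "0 < p" "p < 1"
    and A: "det A > 0" "trace A > 0" "(trace A)\<^sup>2 > 4 * det A" "opnorm A < 1"
    and h: "h1 + h2 = trace A" "h1 * h2 = det A" "h2 < h1"
    and b: "b > 0" "opnorm (b *\<^sub>R rot J t) < 1" and m: "m \<ge> 1"
    and aligned: "trace (A ** rot J (real m * t)) = h2 * trace (rot J (real m * t))"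
    and s: "s > 0" "sqrt (det A) powr (s * (1 - q)) * p powr q > 1"
  shows "r_dim q A (b *\<^sub>R rot J t) p \<le> s"
proof -
  define \<alpha> a where "\<alpha> = sqrt (det A)" and "a = s * (1 - q)"
  define B where "B = b *\<^sub>R rot J t"
  define M where "M = mpow B m"
  have M: "M = b ^ m *\<^sub>R rot J (real m * t)" by (simp add: M_def B_def mpow_rot)
  have detM: "det M = (b ^ m)\<^sup>2" by (simp add: M det_scaleR_2 det_rot)
  have detB: "det B = b\<^sup>2" by (simp add: B_def det_scaleR_2 det_rot)
  have h_pos: "0 < h1" "0 < h2"
    using h A by (smt (verit) mult_le_0_iff)+
  have tr: "trace (mpow A k ** M) = h2 ^ k * trace M" for k
  proof (rule trace_mpow_mult[OF h(1,2)])
    have "A ** M = b ^ m *\<^sub>R (A ** rot J (real m * t))"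
      by (simp add: M mat2_eq_iff matrix_mult_2 algebra_simps)
    thus "trace (A ** M) = h2 * trace M" using aligned by (simp add: M trace_scaleR)
  qed
  define X where "X = \<alpha> powr a * p powr q"
  have X: "X > 1" using s by (simp add: X_def \<alpha>_def a_def)
  \<comment> \<open>The contribution of the \<open>m\<close> letters 2. The whole word contributes
    \<open>X ^ k * c\<close>, so \<open>k\<close> is chosen with
    \<open>1 / X ^ k < c\<close>.\<close>
  define c where "c = (b ^ m) powr a * ((1 - p) powr q) ^ m"
  have c: "c > 0" using b p by (simp add: c_def)
  \<comment> \<open>The squared trace of \<open>mpow A k ** M\<close> divided by its determinant is
    this sequence divided by \<open>det M\<close>; ellipticity means that the quotient is below
    4.\<close>
  have "(\<lambda>k. (h2 / h1) ^ k * (trace M)\<^sup>2) \<longlonglongrightarrow> 0 * (trace M)\<^sup>2"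
    using h_pos h(3) by (intro tendsto_intros LIMSEQ_power_zero) auto
  hence "\<forall>\<^sub>F k in sequentially. (h2 / h1) ^ k * (trace M)\<^sup>2 < 4 * det M"
    using b by (intro order_tendstoD(2)) (auto simp: detM)
  moreover have "(\<lambda>k. (1 / X) ^ k) \<longlonglongrightarrow> 0"
    using X by (intro LIMSEQ_power_zero) auto
  hence "\<forall>\<^sub>F k in sequentially. (1 / X) ^ k < c" using c by (rule order_tendstoD(2))
  ultimately have "\<forall>\<^sub>F k in sequentially. (h2 / h1) ^ k * (trace M)\<^sup>2 < 4 * det M \<and> (1 / X) ^ k < c"
    by (rule eventually_conj)
  then obtain k where k: "(h2 / h1) ^ k * (trace M)\<^sup>2 < 4 * det M" "(1 / X) ^ k < c"
    by (auto simp: eventually_sequentially)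
  define W where "W = mpow A k ** M"
  have detW: "det W = det A ^ k * det M" by (simp add: W_def det_mul det_mpow)
  have "(h2 ^ k)\<^sup>2 * (trace M)\<^sup>2 = (h1 * h2) ^ k * ((h2 / h1) ^ k * (trace M)\<^sup>2)"
    using h_pos by (simp add: power_mult_distrib power_divide power2_eq_square)
  also have "\<dots> < (h1 * h2) ^ k * (4 * det M)"
    using k(1) h_pos by (intro mult_strict_left_mono) auto
  finally have "(trace W)\<^sup>2 < 4 * det W"
    unfolding detW tr[of k, folded W_def] h(2)[symmetric]
    by (simp add: power_mult_distrib algebra_simps)
  then obtain C where C: "C > 0" "\<And>j. opnorm (mpow W j) \<le> C * sqrt (det W) ^ j"
    by (rule mpow_opnorm_bound) blast
  define u where "u = replicate k (1::nat) @ replicate m 2"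
  have u: "u \<in> words (k + m)" by (auto simp: words_def u_def)
  have W: "word_prod A B u = W"
    by (simp add: u_def word_prod_append word_prod_replicate W_def M_def)
  have sqrtW: "sqrt (det W) = \<alpha> ^ k * b ^ m"
    using b by (simp add: detW detM \<alpha>_def real_sqrt_mult real_sqrt_power[of "det A" k])
  have \<alpha>: "\<alpha> > 0" using A by (simp add: \<alpha>_def)
  have "sqrt (det W) powr a * word_weight q p u = X ^ k * c"
    using \<alpha> b unfolding sqrtW
    by (simp add: u_def word_weight_append word_weight_replicate X_def c_def powr_mult
        power_powr_swap power_mult_distrib)
  also have "\<dots> \<ge> 1"
    using k(2) X by (simp add: power_one_over field_simps)
  finally have ge1: "1 \<le> sqrt (det W) powr (s * (1 - q)) * word_weight q p u"
    by (simp add: a_def)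
  have "\<not> summable (\<lambda>n. word_sum q A B p s' (Suc n))" if "s \<le> s'" for s'
  proof (rule not_summable_word_sum[OF q _ _ _ _ s(1) that u _ C(1) _ _ ge1])
    show "0 < sqrt (det W)" using \<alpha> b by (simp add: sqrtW)
    show "opnorm (mpow (word_prod A B u) j) \<le> C * sqrt (det W) ^ j" for j
      unfolding W by (rule C(2))
  qed (use A b m detB in \<open>auto simp: B_def\<close>)
  thus ?thesis
    unfolding B_def[symmetric] using A b detB by (intro r_dim_le[OF q p]) auto
qed

text \<open>Angles having an aligned multiple are dense. Along a sequence of them tending to
  \<open>\<theta>\<close> the value of \<open>r_dim\<close> is at most \<open>s\<close>, while the
  limit pair has a larger one.\<close>

lemma r_discontinuous_atI:
  fixes A :: mat2
  assumes q: "q > 1" and p: "0 < p" "p < 1"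
    and A: "det A > 0" "trace A > 0" "(trace A)\<^sup>2 > 4 * det A" "opnorm A < 1"
    and b: "b > 0" "opnorm (b *\<^sub>R rot J \<theta>) < 1"
    and s: "s > 0" "sqrt (det A) powr (s * (1 - q)) * p powr q > 1"
    and less: "s < r_dim q A (b *\<^sub>R rot J \<theta>) p"
  shows "r_discontinuous_at q p (A, b *\<^sub>R rot J \<theta>)"
proof -
  define r where "r = sqrt ((trace A)\<^sup>2 - 4 * det A)"
  have r: "r > 0" "r * r = (trace A)\<^sup>2 - 4 * det A" using A by (simp_all add: r_def)
  define h1 h2 where "h1 = (trace A + r) / 2" and "h2 = (trace A - r) / 2"
  have h: "h1 + h2 = trace A" "h1 * h2 = det A" "h2 < h1"
    using r by (simp_all add: h1_def h2_def field_simps power2_eq_square)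
  \<comment> \<open>\<open>A - h2\<close> has rank one: its image is the expanding eigenline and its
    kernel the contracting one. Its product with a matrix R has trace zero exactly when R maps the
    image into the kernel. For \<open>rot J t\<close> this is a linear equation in
    \<open>cos t\<close> and \<open>sin t\<close>, with coefficients \<open>x\<close> and
    \<open>y\<close>.\<close>
  define x y where "x = trace A - 2 * h2" and "y = trace (A ** J)"
  have aligned: "trace (A ** rot J t) - h2 * trace (rot J t) = cos t * x + sin t * y" for t
    using J_entry by (simp add: rot_def x_def y_def trace_2 matrix_mult_2 mat_2 algebra_simps)
  obtain \<psi> where \<psi>: "cos \<psi> * x + sin \<psi> * y = 0"
  proof (cases "y = 0")
    case True
    thus ?thesis using that[of "pi / 2"] by simp
  next
    case False
    have "sin (arctan (- x / y)) = - x / y * cos (arctan (- x / y))"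
      using tan_arctan[of "- x / y"] cos_arctan_not_zero[of "- x / y"]
      by (simp add: tan_def field_simps)
    hence "cos (arctan (- x / y)) * x + sin (arctan (- x / y)) * y = 0"
      using False by simp
    thus ?thesis by (rule that)
  qed
  \<comment> \<open>The aligned angles include all \<open>\<psi>\<close> plus integer multiples of
    \<open>pi\<close>. Rounding \<open>Suc n\<close> times \<open>\<theta>\<close> down to one of
    them and dividing by \<open>Suc n\<close> leaves an error of at most
    \<open>pi / Suc n\<close>.\<close>
  define j where "j n = \<lfloor>(real (Suc n) * \<theta> - \<psi>) / pi\<rfloor>" for n
  define t where "t n = (\<psi> + of_int (j n) * pi) / real (Suc n)" for n
  have al: "trace (A ** rot J (real (Suc n) * t n)) = h2 * trace (rot J (real (Suc n) * t n))" for n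
  proof -
    have "real (Suc n) * t n = \<psi> + of_int (j n) * pi" by (simp add: t_def del: of_nat_Suc)
    moreover have "sin (of_int (j n) * pi) = 0" by (auto simp: sin_zero_iff_int2)
    hence "cos (\<psi> + of_int (j n) * pi) * x + sin (\<psi> + of_int (j n) * pi) * y
        = cos (of_int (j n) * pi) * (cos \<psi> * x + sin \<psi> * y)"
      by (simp add: cos_add sin_add algebra_simps)
    ultimately show ?thesis using aligned[of "real (Suc n) * t n"] \<psi> by simp
  qed
  have tlim: "t \<longlonglongrightarrow> \<theta>"
  proof (rule LIMSEQ_I)
    fix e :: real assume "e > 0"
    then obtain N where N: "pi / e < real N" using reals_Archimedean2 by blast
    have "norm (t n - \<theta>) < e" if "n \<ge> N" for n
    proof -
      define z where "z = (real (Suc n) * \<theta> - \<psi>) / pi"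
      have "of_int (j n) \<le> z" "z < of_int (j n) + 1" by (simp_all add: j_def z_def)
      hence "\<bar>of_int (j n) - z\<bar> \<le> 1" by linarith
      moreover have "t n - \<theta> = pi * (of_int (j n) - z) / real (Suc n)"
      proof -
        have "pi * z = real (Suc n) * \<theta> - \<psi>" by (simp add: z_def)
        hence "\<theta> = (\<psi> + pi * z) / real (Suc n)" by simp
        thus ?thesis unfolding t_def by (simp add: diff_divide_distrib[symmetric] algebra_simps)
      qed
      ultimately have "norm (t n - \<theta>) \<le> pi / real (Suc n)"
        by (simp add: abs_mult divide_right_mono mult_left_le)
      also have "\<dots> < e"
        using N that \<open>e > 0\<close> by (simp add: field_simps) (smt (verit) mult_left_mono of_nat_mono)
      finally show ?thesis .
    qed
    thus "\<exists>N. \<forall>n\<ge>N. norm (t n - \<theta>) < e" by blast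
  qed
  define B where "B n = b *\<^sub>R rot J (t n)" for n
  have Blim: "B \<longlonglongrightarrow> b *\<^sub>R rot J \<theta>"
    unfolding B_def rot_def by (intro tendsto_intros tlim)
  have "(\<lambda>n. opnorm (B n)) \<longlonglongrightarrow> opnorm (b *\<^sub>R rot J \<theta>)"
    by (rule continuous_on_tendsto_compose[OF continuous_on_opnorm[of UNIV] Blim]) auto
  \<comment> \<open>A conjugate of a rotation need not be an isometry, so the perturbed pairs are
    known to lie in the domain only for large \<open>n\<close>.\<close>
  hence ev: "\<forall>\<^sub>F n in sequentially. opnorm (B n) < 1" using b(2) by (rule order_tendstoD(2))
  have det: "det (b *\<^sub>R rot J u) = b\<^sup>2" for u by (simp add: det_scaleR_2 det_rot)
  have dom: "(A, b *\<^sub>R rot J u) \<in> pair_domain" if "opnorm (b *\<^sub>R rot J u) < 1" for u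
    using that A b by (simp add: pair_domain_def invertible_det_nz det)
  have "\<not> continuous (at (A, b *\<^sub>R rot J \<theta>) within pair_domain) (\<lambda>(A1, A2). r_dim q A1 A2 p)"
  proof
    assume "continuous (at (A, b *\<^sub>R rot J \<theta>) within pair_domain) (\<lambda>(A1, A2). r_dim q A1 A2 p)"
    moreover have "\<forall>\<^sub>F n in sequentially. (A, B n) \<in> pair_domain"
      using ev by eventually_elim (auto simp: B_def dom)
    moreover have "(\<lambda>n. (A, B n)) \<longlonglongrightarrow> (A, b *\<^sub>R rot J \<theta>)"
      by (intro tendsto_Pair tendsto_const Blim)
    ultimately have "(\<lambda>n. case (A, B n) of (A1, A2) \<Rightarrow> r_dim q A1 A2 p)
        \<longlonglongrightarrow> (case (A, b *\<^sub>R rot J \<theta>) of (A1, A2) \<Rightarrow> r_dim q A1 A2 p)"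
      by (rule continuous_within_tendsto_compose)
    hence "\<forall>\<^sub>F n in sequentially. s < r_dim q A (B n) p"
      using less by (auto dest: order_tendstoD(1))
    moreover have "\<forall>\<^sub>F n in sequentially. r_dim q A (B n) p \<le> s"
      using ev
    proof eventually_elim
      case (elim n)
      thus ?case unfolding B_def
        by (intro r_dim_le_aligned[OF q p A h b(1) _ _ al s]) auto
    qed
    ultimately have "\<forall>\<^sub>F n :: nat in sequentially. False" by eventually_elim simp
    thus False by simp
  qed
  thus ?thesis using dom[OF b(2)] by (simp add: r_discontinuous_at_def)
qed

end

section \<open>Convergence at the unperturbed pairs\<close>

lemma component_le_opnorm: "\<bar>A $ i $ j\<bar> \<le> opnorm A"
  unfolding opnorm_def by (rule matrix_component_le_onorm)

text \<open>Convexity of the \<open>q\<close>-th power at the midpoint of \<open>p\<close> and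
  \<open>1 - p\<close>.\<close>

lemma two_powr_le_sum_powr:
  fixes p q :: real
  assumes "q > 1" "0 < p" "p < 1"
  shows "2 powr (1 - q) \<le> p powr q + (1 - p) powr q"
proof -
  have "((1 - 1/2) *\<^sub>R p + (1/2) *\<^sub>R (1 - p)) powr q \<le> (1 - 1/2) * p powr q + 1/2 * (1 - p) powr q"
    using assms by (intro convex_onD[OF powr_convex]) auto
  moreover have "(1 - 1/2) *\<^sub>R p + (1/2) *\<^sub>R (1 - p) = 1 / 2" by (simp add: field_simps)
  ultimately have "(1 / 2) powr q \<le> (1 - 1/2) * p powr q + 1/2 * (1 - p) powr q" by metis
  hence "2 * (1 / 2) powr q \<le> p powr q + (1 - p) powr q" by simp
  moreover have "2 * (1 / 2) powr q = 2 powr (1 - q)"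
    by (simp add: powr_diff powr_divide)
  ultimately show ?thesis by simp
qed

text \<open>The exponent \<open>s * (1 - q)\<close> is negative, so a lower bound on the norm
  becomes an upper bound on the term.\<close>

lemma phi_powr_le:
  assumes "q > 1" "0 < s" "s \<le> 1" "0 < x" "x \<le> opnorm A"
  shows "phi s A powr (1 - q) \<le> x powr (s * (1 - q))"
proof -
  have "phi s A powr (1 - q) = opnorm A powr (s * (1 - q))"
    using assms by (simp add: phi_eq_opnorm_powr powr_powr)
  also have "\<dots> \<le> x powr (s * (1 - q))"
    using assms by (intro powr_mono2') (auto simp: mult_nonneg_nonpos)
  finally show ?thesis .
qed

lemma sum_word_weight: "(\<Sum>w\<in>words n. word_weight q p w) = (p powr q + (1 - p) powr q) ^ n"
  unfolding word_weight_def sum_words_prod_list by simp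

lemma summable_word_sum_of_opnorm_ge:
  assumes q: "q > 1" and p: "0 < p" "p < 1" and s: "0 < s" "s \<le> 1" and l: "0 < l"
    and ge: "\<And>w. l ^ length w \<le> opnorm (word_prod A B w)"
    and less: "l powr (s * (1 - q)) * (p powr q + (1 - p) powr q) < 1"
  shows "summable (\<lambda>n. word_sum q A B p s (Suc n))"
proof (rule summable_word_sum[where a = 1 and b = 0 and y = 0
      and x = "l powr (s * (1 - q)) * (p powr q + (1 - p) powr q)"])
  fix n
  define x where "x = l powr (s * (1 - q))"
  have "word_sum q A B p s n \<le> (\<Sum>w\<in>words n. x ^ n * word_weight q p w)"
    unfolding word_sum_def
  proof (intro sum_mono mult_right_mono word_weight_nonneg)
    fix w assume "w \<in> words n"
    hence "l ^ n \<le> opnorm (word_prod A B w)" using ge[of w] by (simp add: words_def)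
    hence "phi s (word_prod A B w) powr (1 - q) \<le> (l ^ n) powr (s * (1 - q))"
      using q s l by (intro phi_powr_le) auto
    thus "phi s (word_prod A B w) powr (1 - q) \<le> x ^ n"
      using l by (simp add: x_def power_powr_swap)
  qed
  also have "\<dots> = x ^ n * (p powr q + (1 - p) powr q) ^ n"
    by (simp only: sum_distrib_left[symmetric] sum_word_weight)
  finally show "word_sum q A B p s n
      \<le> 1 * (l powr (s * (1 - q)) * (p powr q + (1 - p) powr q)) ^ n + 0 * 0 ^ n"
    by (simp add: x_def power_mult_distrib)
qed (use less in auto)

section \<open>The diagonal pair\<close>

lemma opnorm_diag_le:
  assumes "\<bar>a\<bar> \<le> r" "\<bar>d\<bar> \<le> r"
  shows "opnorm (vector [vector [a, 0], vector [0, d]]) \<le> r"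
proof (rule opnorm_le)
  fix x :: "real^2"
  have r: "0 \<le> r" using assms(1) by linarith
  have "a\<^sup>2 * (x$1)\<^sup>2 + d\<^sup>2 * (x$2)\<^sup>2 \<le> r\<^sup>2 * (x$1)\<^sup>2 + r\<^sup>2 * (x$2)\<^sup>2"
    by (intro add_mono mult_right_mono zero_le_power2 power2_le_iff_abs_le[THEN iffD2] r assms)
  hence "(norm (vector [vector [a, 0], vector [0, d]] *v x :: real^2))\<^sup>2 \<le> (r * norm x)\<^sup>2"
    by (simp add: norm_2_sq matrix_vector_mult_2 power_mult_distrib distrib_left)
  thus "norm (vector [vector [a, 0], vector [0, d]] *v x :: real^2) \<le> r * norm x"
    by (intro power2_le_imp_le[OF _ mult_nonneg_nonneg[OF r norm_ge_zero]])
qed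

lemma r_discontinuous_at_diagonal:
  fixes q p \<delta> l :: real
  assumes q: "q > 1" and p: "0 < p" "p < 1" and l: "0 < \<delta>" "\<delta> < l" "l < 1 / 2"
    and less: "ln (min (p powr q) ((1 - p) powr q)) / ln (sqrt (l * \<delta>))
        < ln (p powr q + (1 - p) powr q) / ln l"
  shows "r_discontinuous_at q p
    (vector [vector [l, 0], vector [0, \<delta>]], vector [vector [l, 0], vector [0, l]])"
proof -
  define A B :: mat2
    where "A = vector [vector [l, 0], vector [0, \<delta>]]" and "B = vector [vector [l, 0], vector [0, l]]"
  define J :: mat2 where "J = vector [vector [0, - 1], vector [1, 0]]"
  define P where "P = p powr q + (1 - p) powr q"
  define lam where "lam = ln (sqrt (l * \<delta>))"
  have J: "trace J = 0" "det J = 1" by (simp_all add: J_def trace_2 det_2)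
  have B: "B = l *\<^sub>R rot J 0"
    by (simp add: B_def rot_def mat2_eq_iff mat_2)
  have l1: "l * \<delta> < 1" using l mult_strict_mono[of l 1 \<delta> 1] by simp
  have lam: "lam < 0" and lnl: "ln l < - ln 2"
    using l l1 ln_less_cancel_iff[of l "1/2"] by (simp_all add: lam_def ln_div)
  have P: "0 < P" using p by (simp add: P_def add_pos_pos)
  \<comment> \<open>Two thresholds: \<open>s1\<close> solves
    \<open>sqrt (det A) powr (s * (1 - q)) * p powr q = 1\<close> and governs divergence at nearby
    pairs, \<open>s0\<close> solves \<open>l powr (s * (1 - q)) * P = 1\<close> and governs
    convergence at the pair itself. The smallness of \<open>\<delta>\<close> yields
    \<open>s1 < s0\<close>, as the minimum is at most \<open>p powr q\<close> and
    \<open>lam < 0\<close>.\<close>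
  define s1 s0 where "s1 = q * ln p / ((q - 1) * lam)" and "s0 = ln P / ((q - 1) * ln l)"
  have "q * ln p / lam \<le> ln (min (p powr q) ((1 - p) powr q)) / lam"
  proof (rule divide_right_mono_neg)
    show "ln (min (p powr q) ((1 - p) powr q)) \<le> q * ln p"
      using p ln_le_cancel_iff[of "min (p powr q) ((1 - p) powr q)" "p powr q"]
      by (simp add: ln_powr)
  qed (use lam in simp)
  hence "q * ln p / lam < ln P / ln l" using less by (simp add: lam_def P_def)
  hence s10: "s1 < s0"
    using q divide_strict_right_mono[of "q * ln p / lam" "ln P / ln l" "q - 1"]
    by (simp add: s1_def s0_def mult.commute)
  have s1: "0 < s1"
    using p q lam by (auto simp: s1_def intro!: divide_neg_neg mult_pos_neg)
  \<comment> \<open>From \<open>l < 1 / 2\<close> follows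
    \<open>l powr (q - 1) < 2 powr (1 - q) \<le> P\<close>, hence \<open>s0 < 1\<close>, the range
    in which \<open>phi\<close> is a power of the norm.\<close>
  have "(1 - q) * ln 2 \<le> ln P"
    using two_powr_le_sum_powr[OF q p] P ln_le_cancel_iff[of "2 powr (1 - q)" P]
    by (simp add: P_def ln_powr)
  moreover have "(q - 1) * ln l < (q - 1) * (- ln 2)"
    using q lnl by (intro mult_strict_left_mono) auto
  ultimately have "(q - 1) * ln l < ln P" by (simp add: algebra_simps)
  moreover have neg: "(q - 1) * ln l < 0" using q lnl ln_gt_zero[of "2::real"] by (intro mult_pos_neg) linarith+
  ultimately have s0: "s0 < 1" by (simp add: s0_def divide_less_eq)
  define s s' where "s = s1 + (s0 - s1) / 3" and "s' = s1 + 2 * (s0 - s1) / 3"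
  have s: "s1 < s" "s < s'" "s' < s0" using s10 by (simp_all add: s_def s'_def field_simps)
  \<comment> \<open>Both matrices are diagonal with upper left entry \<open>l\<close>, so this entry
    depends only on the length of the word.\<close>
  have ge: "l ^ length w \<le> opnorm (word_prod A B w)" for w
  proof -
    have "(word_prod A B w) $ 1 $ 1 = l ^ length w"
      by (induction w) (simp_all add: matrix_mult_2 A_def B_def mat_2)
    thus ?thesis using component_le_opnorm[of "word_prod A B w" 1 1] by simp
  qed
  have nA: "opnorm A < 1" and nB: "opnorm B < 1"
    using opnorm_diag_le[of l l \<delta>] opnorm_diag_le[of l l l] l by (auto simp: A_def B_def)
  have det: "det A = l * \<delta>" "trace A = l + \<delta>" "det B = l * l"
    by (simp_all add: A_def B_def det_2 trace_2)
  have "s' * (1 - q) * ln l + ln P < 0"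
  proof -
    have "s' * ((q - 1) * ln l) > s0 * ((q - 1) * ln l)"
      using s neg by (intro mult_strict_right_mono_neg)
    moreover have "s0 * ((q - 1) * ln l) = ln P"
      unfolding s0_def using neg by (intro nonzero_eq_divide_eq[THEN iffD1, OF _ refl] less_imp_neq)
    ultimately show ?thesis by (simp add: algebra_simps)
  qed
  hence "exp (s' * (1 - q) * ln l + ln P) < 1" by simp
  hence "l powr (s' * (1 - q)) * P < 1"
    using P l by (simp add: powr_def exp_add)
  hence "s' \<le> r_dim q A B p"
    using l s s0 s1
    by (intro r_dim_ge[OF q p _ _ nA nB] summable_word_sum_of_opnorm_ge[OF q p _ _ _ ge])
       (auto simp: det P_def)
  moreover have "sqrt (det A) powr (s * (1 - q)) * p powr q > 1"
  proof -
    have neg': "(q - 1) * lam < 0" using q lam by (intro mult_pos_neg) auto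
    have "s * ((q - 1) * lam) < s1 * ((q - 1) * lam)"
      using s neg' by (intro mult_strict_right_mono_neg)
    moreover have "s1 * ((q - 1) * lam) = q * ln p"
      unfolding s1_def using neg' by (intro nonzero_eq_divide_eq[THEN iffD1, OF _ refl] less_imp_neq)
    ultimately have "0 < s * (1 - q) * lam + q * ln p" by (simp add: algebra_simps)
    hence "1 < exp (s * (1 - q) * lam + q * ln p)" by simp
    thus ?thesis using l p by (simp add: det powr_def exp_add lam_def)
  qed
  ultimately have "r_discontinuous_at q p (A, l *\<^sub>R rot J 0)"
  proof (intro r_discontinuous_atI[OF J q p, where s = s])
    have "(l + \<delta>)\<^sup>2 - 4 * (l * \<delta>) = (l - \<delta>)\<^sup>2" by (simp add: power2_eq_square algebra_simps)
    moreover have "(l - \<delta>)\<^sup>2 > 0" using l by simp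
    ultimately show "(trace A)\<^sup>2 > 4 * det A" unfolding det by linarith
  qed (use l nA nB s s1 det in \<open>auto simp: B\<close>)
  thus ?thesis unfolding B[symmetric] by (simp add: A_def B_def)
qed

section \<open>Resistant pairs\<close>

lemma prod_list_two_powr_count:
  "prod_list (map (\<lambda>i. if i = 2 then 2 else 1) w) = (2::real) ^ count_list w (2::nat)"
  by (induction w) simp_all

text \<open>\<open>X\<close> and \<open>T\<close> are the weights of the letters 1 and 2 when norms
  are replaced by square roots of determinants. Words with at most \<open>e * n\<close> letters 2
  gain \<open>L ^ n\<close> by resistance; for the others, doubling \<open>T\<close> pays for the
  decaying factor \<open>2 powr (- e)\<close> per letter. The constant \<open>c\<close> affects only
  a coefficient, not a ratio.\<close>

lemma summable_word_sum_resistant: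
  fixes A B :: mat2
  defines "g \<equiv> \<lambda>i::nat. if i = 1 then sqrt (det A) else sqrt (det B)"
  assumes q: "q > 1" and p: "0 < p" "p < 1" and s: "0 < s" "s \<le> 1"
    and det: "det A > 0" "det B > 0" and cel: "c > 0" "e > 0" "L > 1"
    and res: "\<And>n w. n \<ge> 1 \<Longrightarrow> w \<in> words n \<Longrightarrow> real (count_list w 2) \<le> e * real n \<Longrightarrow>
      c * L ^ n * prod_list (map g w) \<le> opnorm (word_prod A B w)"
    and X: "X = sqrt (det A) powr (s * (1 - q)) * p powr q"
    and T: "T = sqrt (det B) powr (s * (1 - q)) * (1 - p) powr q"
    and less1: "L powr (s * (1 - q)) * (X + T) < 1" and less2: "X + 2 * T < 2 powr e"
  shows "summable (\<lambda>n. word_sum q A B p s (Suc n))"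
proof (rule summable_word_sum[where a = "c powr (s * (1 - q))" and b = 1
      and x = "L powr (s * (1 - q)) * (X + T)" and y = "2 powr (- e) * (X + 2 * T)"])
  fix n
  define a where "a = s * (1 - q)"
  define f where "f i = g i powr a * (if i = 1 then p else 1 - p) powr q" for i :: nat
  define h where "h i = (if i = 2 then 2 else 1) * f i" for i :: nat
  have g: "g i > 0" for i using det by (simp add: g_def)
  have f: "f i > 0" for i using g[of i] p by (simp add: f_def)
  have h: "h i > 0" for i using f[of i] by (simp add: h_def)
  have ga: "prod_list (map g w) powr a * word_weight q p w = prod_list (map f w)" for w
    unfolding f_def prod_list_map_mult[symmetric] word_weight_def prod_list_map_powr[OF g] ..
  have bound: "phi s (word_prod A B w) powr (1 - q) * word_weight q p w
      \<le> c powr a * (L powr a) ^ n * prod_list (map f w) + (2 powr (- e)) ^ n * prod_list (map h w)"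
    (is "?t \<le> ?b1 + ?b2") if w: "w \<in> words n" for w
  proof -
    have gw: "0 < prod_list (map g w)" by (intro prod_list_map_pos g)
    have nonneg: "0 \<le> ?b1" "0 \<le> ?b2"
      using prod_list_map_pos[of f w] prod_list_map_pos[of h w] f h by simp_all
    show ?thesis
    proof (cases "n \<ge> 1 \<and> real (count_list w 2) \<le> e * real n")
      case True
      hence "phi s (word_prod A B w) powr (1 - q) \<le> (c * L ^ n * prod_list (map g w)) powr a"
        unfolding a_def using w cel gw by (intro phi_powr_le q s res) auto
      also have "\<dots> = c powr a * (L powr a) ^ n * prod_list (map g w) powr a"
        using cel gw by (simp add: powr_mult power_powr_swap)
      finally have "?t \<le> c powr a * (L powr a) ^ n * prod_list (map g w) powr a * word_weight q p w"
        by (rule mult_right_mono) (rule word_weight_nonneg)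
      also have "\<dots> = ?b1" by (simp add: ga[symmetric])
      finally show ?thesis using nonneg by linarith
    next
      case False
      \<comment> \<open>more than \<open>e * n\<close> letters \<open>2\<close>: the determinant bound suffices, after inserting the factor
        \<open>2 ^ (count_list w 2 - e * n) \<ge> 1\<close>\<close>
      have "prod_list (map g w) = sqrt (det (word_prod A B w))"
        unfolding det_word_prod g_def by (induction w) (simp_all add: real_sqrt_mult)
      also have "\<dots> \<le> opnorm (word_prod A B w)"
        using abs_det_le_opnorm[of "word_prod A B w"] opnorm_nonneg by (intro real_le_lsqrt) auto
      finally have "phi s (word_prod A B w) powr (1 - q) \<le> prod_list (map g w) powr a"
        unfolding a_def using gw by (intro phi_powr_le q s)
      hence "?t \<le> prod_list (map g w) powr a * word_weight q p w"
        by (rule mult_right_mono) (rule word_weight_nonneg)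
      also have "\<dots> = 1 * prod_list (map f w)" by (simp add: ga)
      also have "\<dots> \<le> (2 powr (- e * real n) * 2 ^ count_list w 2) * prod_list (map f w)"
      proof (rule mult_right_mono)
        have "e * real n \<le> real (count_list w 2)"
          using False by (cases "n = 0") auto
        hence "2 powr 0 \<le> 2 powr (- e * real n + real (count_list w 2))"
          by (intro powr_mono) auto
        thus "1 \<le> 2 powr (- e * real n) * 2 ^ count_list w 2"
          unfolding powr_add by (simp add: powr_realpow)
      qed (use prod_list_map_pos[of f w] f in simp)
      also have "\<dots> = 2 powr (- e * real n) * prod_list (map h w)"
        unfolding h_def prod_list_map_mult[symmetric] prod_list_two_powr_count by simp
      also have "\<dots> = ?b2" by (simp add: powr_power mult.commute)
      finally show ?thesis using nonneg by linarith
    qed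
  qed
  have "word_sum q A B p s n
      \<le> (\<Sum>w\<in>words n. c powr a * (L powr a) ^ n * prod_list (map f w) + (2 powr (- e)) ^ n * prod_list (map h w))"
    unfolding word_sum_def by (intro sum_mono bound)
  also have "\<dots> = c powr a * (L powr a) ^ n * (X + T) ^ n + (2 powr (- e)) ^ n * (X + 2 * T) ^ n"
    unfolding sum.distrib sum_distrib_left[symmetric] sum_words_prod_list
    by (simp add: h_def f_def X T g_def a_def)
  finally show "word_sum q A B p s n
      \<le> c powr a * (L powr (s * (1 - q)) * (X + T)) ^ n + 1 * (2 powr (- e) * (X + 2 * T)) ^ n"
    by (simp add: power_mult_distrib a_def)
next
  have XT: "0 \<le> X" "0 \<le> T" by (simp_all add: X T)
  thus "0 \<le> L powr (s * (1 - q)) * (X + T)" "0 \<le> 2 powr (- e) * (X + 2 * T)" by simp_all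
  show "L powr (s * (1 - q)) * (X + T) < 1" by (rule less1)
  have "2 powr (- e) * (X + 2 * T) < 2 powr (- e) * 2 powr e"
    using less2 by (intro mult_strict_left_mono) auto
  thus "2 powr (- e) * (X + 2 * T) < 1" by (simp add: powr_add[symmetric])
qed

text \<open>The constraint \<open>sqrt \<alpha> \<le> \<beta>\<close> makes the weight \<open>T\<close> of the letter \<open>2\<close> exponentially small in \<open>q\<close>
  at the exponent \<open>s1\<close> where the letter \<open>1\<close> has weight \<open>1\<close>.\<close>

lemma exponents_exist:
  fixes L e :: real
  assumes L: "L > 1" and e: "e > 0"
  obtains Q where "Q > 1" "\<And>p q \<alpha> \<beta>. \<lbrakk>1/2 \<le> p; p < 1; q > Q; 1/32 < \<alpha>; \<alpha> < 1/4; sqrt \<alpha> \<le> \<beta>\<rbrakk> \<Longrightarrow>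
    \<exists>s s0. 0 < s \<and> s < s0 \<and> s0 \<le> 1 \<and> \<alpha> powr (s * (1 - q)) * p powr q > 1 \<and>
      L powr (s0 * (1 - q)) * (\<alpha> powr (s0 * (1 - q)) * p powr q + \<beta> powr (s0 * (1 - q)) * (1 - p) powr q) < 1 \<and>
      \<alpha> powr (s0 * (1 - q)) * p powr q + 2 * (\<beta> powr (s0 * (1 - q)) * (1 - p) powr q) < 2 powr e"
proof -
  \<comment> \<open>The size allowed for \<open>\<tau>\<close>. The first entry serves the
    inequality with \<open>L\<close>, where \<open>v < ln 32\<close> is used; the second serves
    \<open>1 + 2 * T s1 < 2 powr e\<close>.\<close>
  define \<kappa> where "\<kappa> = min (ln L / ln 32) (2 powr e - 1)"
  have "2 powr 0 < 2 powr e" using e by (intro powr_less_mono) auto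
  hence \<kappa>: "\<kappa> > 0" using L by (simp add: \<kappa>_def)
  \<comment> \<open>The second entry makes \<open>\<tau>\<close>, twice
    \<open>2 powr (- q / 2)\<close>, smaller than \<open>\<kappa>\<close>; the first gives
    \<open>q > 2\<close>, which yields \<open>s1 < 1\<close>.\<close>
  define Q where "Q = max 2 (- 2 * ln (\<kappa> / 2) / ln 2)"
  show ?thesis
  proof (rule that)
    show "Q > 1" by (simp add: Q_def)
    fix p q \<alpha> \<beta> :: real
    assume p: "1/2 \<le> p" "p < 1" and q: "q > Q" and \<alpha>: "1/32 < \<alpha>" "\<alpha> < 1/4" and \<beta>: "sqrt \<alpha> \<le> \<beta>"
    have q2: "q > 2" and qk: "- 2 * ln (\<kappa> / 2) / ln 2 < q" using q by (simp_all add: Q_def)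
    define u v where "u = - ln p" and "v = - ln \<alpha>"
    define \<tau> where "\<tau> = 2 * exp (- q * ln 2 / 2)"
    have "- q * ln 2 / 2 < ln (\<kappa> / 2)" using qk by (simp add: field_simps)
    hence "exp (- q * ln 2 / 2) < exp (ln (\<kappa> / 2))" by (simp only: exp_less_cancel_iff)
    hence \<tau>: "\<tau> < \<kappa>" using \<kappa> by (simp add: \<tau>_def)
    have \<tau>0: "\<tau> > 0" by (simp add: \<tau>_def)
    have u: "1 - p \<le> u" "u \<le> ln 2"
      using ln_le_minus_one[of p] ln_le_cancel_iff[of "1/2" p] p by (simp_all add: u_def ln_div)
    have v: "2 * ln 2 < v" "v < ln 32"
    proof -
      have "ln \<alpha> < ln (1/4)" "ln (1/32) < ln \<alpha>" using \<alpha> by simp_all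
      moreover have "ln (1/4) = - (2 * ln (2::real))" using ln_realpow[of 2 2] by (simp add: ln_div)
      ultimately show "2 * ln 2 < v" "v < ln 32" by (simp_all add: v_def ln_div)
    qed
    have u0: "u > 0" using u p by linarith
    have v0: "v > 0" using v ln_gt_zero[of "2::real"] by linarith
    have \<beta>0: "\<beta> > 0" using \<alpha> \<beta> by (smt (verit) real_sqrt_gt_0_iff zero_less_divide_1_iff)
    have "ln (sqrt \<alpha>) \<le> ln \<beta>" using \<alpha> \<beta> \<beta>0 by (subst ln_le_cancel_iff) auto
    hence ln\<beta>: "- v / 2 \<le> ln \<beta>" using \<alpha> by (simp add: ln_sqrt v_def)
    define s1 where "s1 = q * u / ((q - 1) * v)"
    have s1a: "s1 * (1 - q) = - (q * u / v)" using q2 v0 by (simp add: s1_def field_simps)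
    have s10: "0 < s1" using q2 u0 v0 by (simp add: s1_def)
    have s11: "s1 < 1"
    proof -
      have "q * u \<le> q * ln 2" using u q2 by (intro mult_left_mono) auto
      also have "\<dots> < (q - 1) * (2 * ln 2)" using q2 by simp
      also have "\<dots> < (q - 1) * v" using v q2 by (intro mult_strict_left_mono) auto
      finally show ?thesis using q2 v0 by (simp add: s1_def)
    qed
    define X T where "X s = \<alpha> powr (s * (1 - q)) * p powr q"
      and "T s = \<beta> powr (s * (1 - q)) * (1 - p) powr q" for s
    have Xeq: "X s = exp (s * (1 - q) * ln \<alpha> + q * ln p)" for s
      using \<alpha> p by (simp add: X_def powr_def exp_add)
    have X1: "X s1 = 1"
      unfolding Xeq s1a using v0 by (simp add: u_def v_def)
    \<comment> \<open>The factor \<open>1 - p\<close> keeps \<open>Q\<close> independent of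
      \<open>p\<close>: as \<open>p\<close> tends to 1, \<open>u\<close> tends to 0 and the gain
      \<open>L powr (s1 * (1 - q)) = exp (- q * u / v * ln L)\<close> tends to 1, so
      \<open>T s1\<close> has to vanish at the rate of \<open>u\<close>.\<close>
    have T1: "T s1 \<le> (1 - p) * \<tau>"
    proof -
      define z where "z = u / 2 + ln (1 - p)"
      have "q * u / v * (- v / 2) \<le> q * u / v * ln \<beta>"
        using ln\<beta> q2 u0 v0 by (intro mult_left_mono) auto
      hence "T s1 \<le> exp (q * u / 2 + q * ln (1 - p))"
        using p \<beta>0 v0 unfolding T_def s1a by (simp add: powr_def flip: exp_add)
      \<comment> \<open>One copy of \<open>z\<close> is kept for the factor \<open>1 - p\<close>;
        the other \<open>q - 1\<close> copies give the decay in \<open>q\<close>, since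
        \<open>z \<le> - ln 2 / 2\<close>.\<close>
      also have "q * u / 2 + q * ln (1 - p) = z + (q - 1) * z"
        by (simp add: z_def field_simps)
      also have "exp \<dots> \<le> exp (ln 2 / 2 + ln (1 - p) + (q - 1) * (- ln 2 / 2))"
      proof -
        have "ln (1 - p) \<le> - ln 2" using p ln_le_cancel_iff[of "1 - p" "1/2"] by (simp add: ln_div)
        hence "z \<le> - ln 2 / 2" using u by (simp add: z_def)
        hence "(q - 1) * z \<le> (q - 1) * (- ln 2 / 2)" using q2 by (intro mult_left_mono) auto
        thus ?thesis using u by (simp add: z_def)
      qed
      also have "ln 2 / 2 + ln (1 - p) + (q - 1) * (- ln 2 / 2) = ln (1 - p) + (ln 2 + - q * ln 2 / 2)"
        by (simp add: field_simps)
      also have "exp \<dots> = (1 - p) * \<tau>" using p unfolding exp_add by (simp add: \<tau>_def)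
      finally show ?thesis .
    qed
    have a: "L powr (s1 * (1 - q)) * (X s1 + T s1) < 1"
    proof -
      have "T s1 \<le> u * \<tau>" using T1 u \<tau>0 by (meson less_imp_le mult_right_mono order_trans)
      also have "\<dots> < u * (ln L / v)"
      proof -
        have "ln L / ln 32 < ln L / v" using v v0 L by (intro divide_strict_left_mono) auto
        hence "\<tau> < ln L / v" using \<tau> by (simp add: \<kappa>_def)
        thus ?thesis using u0 by (rule mult_strict_left_mono)
      qed
      also have "\<dots> \<le> q * (u * (ln L / v))"
        using q2 u0 L v0 mult_right_mono[of 1 q "u * (ln L / v)"] by simp
      finally have T2: "T s1 < q * u / v * ln L" by simp
      have "X s1 + T s1 \<le> exp (T s1)" unfolding X1 by (rule exp_ge_add_one_self)
      hence "L powr (s1 * (1 - q)) * (X s1 + T s1) \<le> L powr (s1 * (1 - q)) * exp (T s1)"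
        by (intro mult_left_mono) auto
      also have "\<dots> = exp (T s1 - q * u / v * ln L)"
        using L unfolding s1a by (simp add: powr_def flip: exp_add)
      also have "\<dots> < 1" using T2 by simp
      finally show ?thesis .
    qed
    have b: "X s1 + 2 * T s1 < 2 powr e"
    proof -
      have "2 * ((1 - p) * \<tau>) \<le> \<tau>" using p \<tau>0 by (simp add: mult_le_cancel_right1 flip: mult.assoc)
      thus ?thesis using T1 \<tau> X1 by (simp add: \<kappa>_def)
    qed
    \<comment> \<open>The strict inequalities at \<open>s1\<close> persist at some larger
      \<open>s0\<close>. As \<open>X\<close> increases, \<open>X s > 1\<close> holds for
      \<open>s\<close> between them.\<close>
    have cont: "isCont (\<lambda>s. L powr (s * (1 - q)) * (X s + T s)) s1" "isCont (\<lambda>s. X s + 2 * T s) s1"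
      unfolding X_def T_def using L \<alpha> \<beta>0 by (auto intro!: continuous_intros)
    have lim: "(f \<longlongrightarrow> f s1) (at_right s1)" if "isCont f s1" for f :: "real \<Rightarrow> real"
      using that unfolding isCont_def by (rule filterlim_at_split[THEN iffD1, THEN conjunct2])
    have "\<forall>\<^sub>F s in at_right s1. L powr (s * (1 - q)) * (X s + T s) < 1"
      using order_tendstoD(2)[OF lim[OF cont(1)] a] .
    moreover have "\<forall>\<^sub>F s in at_right s1. X s + 2 * T s < 2 powr e"
      using order_tendstoD(2)[OF lim[OF cont(2)] b] .
    moreover have "\<forall>\<^sub>F s in at_right s1. s \<in> {s1<..<1}"
      by (rule eventually_at_right_real[OF s11])
    ultimately have "\<forall>\<^sub>F s in at_right s1.
        L powr (s * (1 - q)) * (X s + T s) < 1 \<and> X s + 2 * T s < 2 powr e \<and> s \<in> {s1<..<1}"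
      by eventually_elim blast
    then obtain s0 where s0: "L powr (s0 * (1 - q)) * (X s0 + T s0) < 1" "X s0 + 2 * T s0 < 2 powr e"
        "s1 < s0" "s0 < 1"
      using eventually_happens'[OF trivial_limit_at_right_real] by auto
    define s where "s = (s1 + s0) / 2"
    have s: "s1 < s" "s < s0" using s0 by (simp_all add: s_def)
    have "X s1 < X s"
    proof -
      have "0 < (s - s1) * ((q - 1) * v)" using s q2 v0 by simp
      thus ?thesis unfolding Xeq by (simp add: v_def algebra_simps)
    qed
    hence "1 < X s" by (simp add: X1)
    thus "\<exists>s s0. 0 < s \<and> s < s0 \<and> s0 \<le> 1 \<and> \<alpha> powr (s * (1 - q)) * p powr q > 1 \<and>
      L powr (s0 * (1 - q)) * (\<alpha> powr (s0 * (1 - q)) * p powr q + \<beta> powr (s0 * (1 - q)) * (1 - p) powr q) < 1 \<and>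
      \<alpha> powr (s0 * (1 - q)) * p powr q + 2 * (\<beta> powr (s0 * (1 - q)) * (1 - p) powr q) < 2 powr e"
      using s s0 s10 unfolding X_def T_def by (intro exI[of _ s] exI[of _ s0]) auto
  qed
qed

text \<open>The trace determines the angle, whose sine is nonzero by ellipticity; solving the
  equation for \<open>J\<close> then forces trace 0 and determinant 1.\<close>

lemma elliptic_eq_rot:
  fixes B :: mat2
  assumes "det B > 0" "(trace B)\<^sup>2 < 4 * det B"
  obtains J \<theta> where "trace J = 0" "det J = 1" "B = sqrt (det B) *\<^sub>R rot J \<theta>"
proof -
  define b where "b = sqrt (det B)"
  have b: "b > 0" "b\<^sup>2 = det B" using assms by (simp_all add: b_def)
  define c where "c = trace B / (2 * b)"
  have "\<bar>trace B\<bar>\<^sup>2 < (2 * b)\<^sup>2" using assms b by (simp add: power_mult_distrib)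
  hence "\<bar>trace B\<bar> < 2 * b" by (rule power2_less_imp_less) (use b in simp)
  hence c: "- 1 < c" "c < 1" using b by (simp_all add: c_def field_simps abs_less_iff)
  define \<theta> where "\<theta> = arccos c"
  have cos: "cos \<theta> = c" using c by (simp add: \<theta>_def)
  have sin: "sin \<theta> > 0" using c by (simp add: \<theta>_def arccos_lt_bounded sin_gt_zero)
  define J where "J = (1 / sin \<theta>) *\<^sub>R ((1 / b) *\<^sub>R B - c *\<^sub>R mat 1)"
  show ?thesis
  proof (rule that[of J \<theta>])
    have tr: "trace B = 2 * b * c" using b by (simp add: c_def)
    show "trace J = 0"
      unfolding J_def trace_scaleR trace_sub tr using b by (simp add: trace_I)
    have "det ((1 / b) *\<^sub>R B - c *\<^sub>R mat 1) = det B / b\<^sup>2 - c * trace B / b + c\<^sup>2"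
      by (simp add: det_2 trace_2 mat_2 power2_eq_square algebra_simps add_divide_distrib diff_divide_distrib)
    also have "\<dots> = 1 - c\<^sup>2" using b by (simp add: tr flip: b(2)) (simp add: power2_eq_square)
    also have "\<dots> = (sin \<theta>)\<^sup>2" by (simp add: sin_squared_eq cos)
    finally show "det J = 1" unfolding J_def det_scaleR_2 using sin by (simp add: power_divide)
    show "B = sqrt (det B) *\<^sub>R rot J \<theta>"
      unfolding b_def[symmetric] rot_def J_def cos using b sin by (simp add: algebra_simps)
  qed
qed

text \<open>\<open>exponents_exist\<close> is applied with \<open>\<alpha> = sqrt (det A)\<close>
  and \<open>\<beta> = sqrt (det B)\<close>, so its bounds appear squared. \<open>Q\<close> is
  chosen before \<open>c\<close>, \<open>A\<close> and \<open>B\<close>, hence it serves all pairs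
  with the same \<open>L\<close> and \<open>e\<close>.\<close>

lemma r_discontinuous_at_resistant:
  fixes L e :: real
  assumes L: "L > 1" and e: "e > 0"
  obtains Q where "Q > 1" "\<And>p q c A B. \<lbrakk>1/2 \<le> p; p < 1; q > Q; c > 0;
    1/1024 < det A; det A < 1/16; trace A > 0; (trace A)\<^sup>2 > 4 * det A; opnorm A < 1;
    det B > 0; (trace B)\<^sup>2 < 4 * det B; det A \<le> (det B)\<^sup>2; opnorm B < 1;
    \<And>n w. n \<ge> 1 \<Longrightarrow> w \<in> words n \<Longrightarrow> real (count_list w 2) \<le> e * real n \<Longrightarrow>
      c * L ^ n * prod_list (map (\<lambda>i. if i = 1 then sqrt (det A) else sqrt (det B)) w)
        \<le> opnorm (word_prod A B w)\<rbrakk> \<Longrightarrow> r_discontinuous_at q p (A, B)"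
proof -
  obtain Q where Q: "Q > 1" "\<And>p q \<alpha> \<beta>. \<lbrakk>1/2 \<le> p; p < 1; q > Q; 1/32 < \<alpha>; \<alpha> < 1/4; sqrt \<alpha> \<le> \<beta>\<rbrakk> \<Longrightarrow>
    \<exists>s s0. 0 < s \<and> s < s0 \<and> s0 \<le> 1 \<and> \<alpha> powr (s * (1 - q)) * p powr q > 1 \<and>
      L powr (s0 * (1 - q)) * (\<alpha> powr (s0 * (1 - q)) * p powr q + \<beta> powr (s0 * (1 - q)) * (1 - p) powr q) < 1 \<and>
      \<alpha> powr (s0 * (1 - q)) * p powr q + 2 * (\<beta> powr (s0 * (1 - q)) * (1 - p) powr q) < 2 powr e"
    using exponents_exist[OF L e] by blast
  show ?thesis
  proof (rule that[OF Q(1)])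
    fix p q c :: real and A B :: mat2
    assume p: "1/2 \<le> p" "p < 1" and q: "q > Q" and c: "c > 0"
      and A: "1/1024 < det A" "det A < 1/16" "trace A > 0" "(trace A)\<^sup>2 > 4 * det A" "opnorm A < 1"
      and B: "det B > 0" "(trace B)\<^sup>2 < 4 * det B" "det A \<le> (det B)\<^sup>2" "opnorm B < 1"
      and res: "\<And>n w. n \<ge> 1 \<Longrightarrow> w \<in> words n \<Longrightarrow> real (count_list w 2) \<le> e * real n \<Longrightarrow>
        c * L ^ n * prod_list (map (\<lambda>i. if i = 1 then sqrt (det A) else sqrt (det B)) w)
          \<le> opnorm (word_prod A B w)"
    have q1: "q > 1" and p0: "0 < p" using q Q(1) p by auto
    have detA: "det A > 0" using A(1) by linarith
    have "sqrt ((1/32)\<^sup>2) < sqrt (det A)" "sqrt (det A) < sqrt ((1/4)\<^sup>2)"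
      unfolding real_sqrt_less_iff using A by (simp_all add: power2_eq_square)
    hence \<alpha>: "1/32 < sqrt (det A)" "sqrt (det A) < 1/4" by simp_all
    have "sqrt (det A) \<le> det B" using B by (intro real_le_lsqrt) auto
    hence \<beta>: "sqrt (sqrt (det A)) \<le> sqrt (det B)" by simp
    obtain s s0 where s: "0 < s" "s < s0" "s0 \<le> 1" "sqrt (det A) powr (s * (1 - q)) * p powr q > 1"
      "L powr (s0 * (1 - q)) * (sqrt (det A) powr (s0 * (1 - q)) * p powr q
        + sqrt (det B) powr (s0 * (1 - q)) * (1 - p) powr q) < 1"
      "sqrt (det A) powr (s0 * (1 - q)) * p powr q
        + 2 * (sqrt (det B) powr (s0 * (1 - q)) * (1 - p) powr q) < 2 powr e"
      using Q(2)[OF p q \<alpha> \<beta>] by blast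
    have s0: "s0 > 0" using s by linarith
    have "summable (\<lambda>n. word_sum q A B p s0 (Suc n))"
      by (rule summable_word_sum_resistant[OF q1 p0 p(2) s0 s(3) detA B(1) c e L res refl refl s(5,6)])
    hence "s0 \<le> r_dim q A B p"
      using detA B by (intro r_dim_ge[OF q1 p0 p(2) _ _ A(5) B(4) s0]) auto
    hence less: "s < r_dim q A B p" using s by linarith
    obtain J \<theta> where J: "trace J = 0" "det J = 1" and Beq: "B = sqrt (det B) *\<^sub>R rot J \<theta>"
      using elliptic_eq_rot[OF B(1,2)] by blast
    have "r_discontinuous_at q p (A, sqrt (det B) *\<^sub>R rot J \<theta>)"
      by (rule r_discontinuous_atI[OF J q1 p0 p(2) detA A(3-5) _ _ s(1,4)])
         (use B less in \<open>simp_all flip: Beq\<close>)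
    thus "r_discontinuous_at q p (A, B)" by (simp flip: Beq)
  qed
qed

section \<open>A chart of the hyperbolic-elliptic pairs\<close>

text \<open>The product rule keeps one factor undifferentiated, so induction on the order needs the
  factor itself at the lower order.\<close>

lemma Ck_on_SucD: "Ck_on (Suc k) S f \<Longrightarrow> Ck_on k S f"
proof (induction k arbitrary: f)
  case 0
  thus ?case by (auto intro!: continuous_at_imp_continuous_on differentiable_imp_continuous_within)
next
  case (Suc k)
  have "Ck_on (Suc k) S (\<lambda>x. frechet_derivative f (at x) v)" for v
    using Suc.prems by (simp only: Ck_on.simps(2)[of "Suc k"])
  hence "Ck_on k S (\<lambda>x. frechet_derivative f (at x) v)" for v by (rule Suc.IH)
  thus ?case using Suc.prems by simp
qed

text \<open>An explicit derivative formula agrees with \<open>frechet_derivative\<close> only on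
  \<open>S\<close>. Openness of \<open>S\<close> carries such an agreement through all further
  derivatives.\<close>

lemma Ck_on_cong:
  assumes "open S" "\<And>x. x \<in> S \<Longrightarrow> f x = g x" "Ck_on k S f"
  shows "Ck_on k S g"
  using assms
proof (induction k arbitrary: f g)
  case 0
  thus ?case using continuous_on_cong[of S S f g] by simp
next
  case (Suc k)
  have D: "(g has_derivative frechet_derivative f (at x)) (at x)" if "x \<in> S" for x
    using Suc.prems that
    by (intro has_derivative_transform_within_open[of f _ x UNIV S g])
       (auto simp: frechet_derivative_works)
  have "Ck_on k S (\<lambda>x. frechet_derivative g (at x) v)" for v
  proof (rule Suc.IH[OF Suc.prems(1)])
    show "frechet_derivative f (at x) v = frechet_derivative g (at x) v" if "x \<in> S" for x
      using frechet_derivative_at[OF D[OF that]] by simp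
    show "Ck_on k S (\<lambda>x. frechet_derivative f (at x) v)" using Suc.prems by simp
  qed
  thus ?case using D by (auto simp: differentiable_def)
qed

lemma Ck_on_SucI:
  assumes "open S" "\<And>x. x \<in> S \<Longrightarrow> (f has_derivative f' x) (at x)" "\<And>v. Ck_on k S (\<lambda>x. f' x v)"
  shows "Ck_on (Suc k) S f"
proof -
  have "Ck_on k S (\<lambda>x. frechet_derivative f (at x) v)" for v
  proof (rule Ck_on_cong[OF assms(1) _ assms(3)[of v]])
    show "f' x v = frechet_derivative f (at x) v" if "x \<in> S" for x
      using frechet_derivative_at[OF assms(2)[OF that]] by simp
  qed
  thus ?thesis using assms(2) by (auto simp: differentiable_def)
qed

lemma Ck_on_SucE:
  assumes "Ck_on (Suc k) S f"
  obtains f' where "\<And>x. x \<in> S \<Longrightarrow> (f has_derivative f' x) (at x)" "\<And>v. Ck_on k S (\<lambda>x. f' x v)"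
  using assms that[of "\<lambda>x. frechet_derivative f (at x)"] by (simp add: frechet_derivative_works)

lemma Ck_on_const: "open S \<Longrightarrow> Ck_on k S (\<lambda>x. c)"
proof (induction k arbitrary: c)
  case (Suc k)
  thus ?case by (intro Ck_on_SucI[where f' = "\<lambda>x v. 0"]) auto
qed simp

lemma Ck_on_linear:
  assumes "open S" "bounded_linear f"
  shows "Ck_on k S f"
proof (cases k)
  case 0
  thus ?thesis using assms by (simp add: linear_continuous_on)
next
  case (Suc j)
  thus ?thesis unfolding Suc using assms
    by (intro Ck_on_SucI[where f' = "\<lambda>x. f"] Ck_on_const) (auto intro: bounded_linear_imp_has_derivative)
qed

lemma Ck_on_add: "open S \<Longrightarrow> Ck_on k S f \<Longrightarrow> Ck_on k S g \<Longrightarrow> Ck_on k S (\<lambda>x. f x + g x)"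
proof (induction k arbitrary: f g)
  case (Suc k)
  obtain f' where f: "\<And>x. x \<in> S \<Longrightarrow> (f has_derivative f' x) (at x)" "\<And>v. Ck_on k S (\<lambda>x. f' x v)"
    using Ck_on_SucE[OF Suc.prems(2)] by metis
  obtain g' where g: "\<And>x. x \<in> S \<Longrightarrow> (g has_derivative g' x) (at x)" "\<And>v. Ck_on k S (\<lambda>x. g' x v)"
    using Ck_on_SucE[OF Suc.prems(3)] by metis
  show ?case
    by (rule Ck_on_SucI[where f' = "\<lambda>x v. f' x v + g' x v", OF Suc.prems(1)])
       (auto intro!: has_derivative_add f g Suc)
qed (simp add: continuous_on_add)

lemma Ck_on_bilinear:
  assumes h: "bounded_bilinear h" and S: "open S"
  shows "Ck_on k S f \<Longrightarrow> Ck_on k S g \<Longrightarrow> Ck_on k S (\<lambda>x. h (f x) (g x))"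
proof (induction k arbitrary: f g)
  case 0
  thus ?case using bounded_bilinear.continuous_on[OF h] by simp
next
  case (Suc k)
  obtain f' where f: "\<And>x. x \<in> S \<Longrightarrow> (f has_derivative f' x) (at x)" "\<And>v. Ck_on k S (\<lambda>x. f' x v)"
    using Ck_on_SucE[OF Suc.prems(1)] by metis
  obtain g' where g: "\<And>x. x \<in> S \<Longrightarrow> (g has_derivative g' x) (at x)" "\<And>v. Ck_on k S (\<lambda>x. g' x v)"
    using Ck_on_SucE[OF Suc.prems(2)] by metis
  note D = Ck_on_SucD[OF Suc.prems(1)] Ck_on_SucD[OF Suc.prems(2)]
  show ?case
  proof (rule Ck_on_SucI[where f' = "\<lambda>x v. h (f x) (g' x v) + h (f' x v) (g x)", OF S])
    show "((\<lambda>x. h (f x) (g x)) has_derivative (\<lambda>v. h (f x) (g' x v) + h (f' x v) (g x))) (at x)"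
      if "x \<in> S" for x
      using bounded_bilinear.FDERIV[OF h f(1)[OF that] g(1)[OF that]] .
    show "Ck_on k S (\<lambda>x. h (f x) (g' x v) + h (f' x v) (g x))" for v
      by (intro Ck_on_add[OF S] Suc.IH D f g)
  qed
qed

text \<open>The derivative is a product of the derivative of \<open>f\<close> with reciprocals of
  \<open>f\<close>, to which the induction hypothesis applies.\<close>

lemma Ck_on_inverse:
  fixes f :: "'a::euclidean_space \<Rightarrow> real"
  assumes S: "open S"
  shows "Ck_on k S f \<Longrightarrow> (\<And>x. x \<in> S \<Longrightarrow> f x \<noteq> 0) \<Longrightarrow> Ck_on k S (\<lambda>x. inverse (f x))"
proof (induction k arbitrary: f)
  case 0
  thus ?case by (auto intro: continuous_on_inverse)
next
  case (Suc k)
  obtain f' where f: "\<And>x. x \<in> S \<Longrightarrow> (f has_derivative f' x) (at x)" "\<And>v. Ck_on k S (\<lambda>x. f' x v)"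
    using Ck_on_SucE[OF Suc.prems(1)] by metis
  note mult = Ck_on_bilinear[OF bounded_bilinear_mult S]
  have I: "Ck_on k S (\<lambda>x. inverse (f x))"
    by (rule Suc.IH[OF Ck_on_SucD[OF Suc.prems(1)] Suc.prems(2)])
  show ?case
  proof (rule Ck_on_SucI[where f' = "\<lambda>x v. (- 1) * (inverse (f x) * (f' x v * inverse (f x)))", OF S])
    show "((\<lambda>x. inverse (f x)) has_derivative (\<lambda>v. (- 1) * (inverse (f x) * (f' x v * inverse (f x))))) (at x)"
      if "x \<in> S" for x
      using Deriv.has_derivative_inverse[OF Suc.prems(2)[OF that] f(1)[OF that]] by (simp add: mult.assoc)
    show "Ck_on k S (\<lambda>x. (- 1) * (inverse (f x) * (f' x v * inverse (f x))))" for v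
      by (intro mult Ck_on_const[OF S] I f)
  qed
qed

section \<open>Coordinates on pairs of determinant one\<close>

lemma exhaust_6: "(x::6) = 1 \<or> x = 2 \<or> x = 3 \<or> x = 4 \<or> x = 5 \<or> x = 6"
proof (induct x)
  case (of_int z)
  then have "0 \<le> z" "z < 6" by simp_all
  hence "z = 0 \<or> z = 1 \<or> z = 2 \<or> z = 3 \<or> z = 4 \<or> z = 5" by arith
  thus ?case by auto
qed

lemma hyperbolicI:
  assumes "det A = 1" "(trace A)\<^sup>2 > 4"
  shows "A \<in> hyperbolic"
proof -
  define r where "r = sqrt ((trace A)\<^sup>2 - 4)"
  have r: "r > 0" "r * r = (trace A)\<^sup>2 - 4" using assms by (simp_all add: r_def)
  have "eigenvalue A ((trace A + r) / 2)" "eigenvalue A ((trace A - r) / 2)"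
    unfolding eigenvalue_iff assms(1) using r(2) by (simp_all add: power2_eq_square field_simps)
  moreover have "(trace A + r) / 2 \<noteq> (trace A - r) / 2" using r(1) by simp
  ultimately show ?thesis using assms(1) unfolding hyperbolic_def by blast
qed

lemma ellipticI:
  assumes "det A = 1" "(trace A)\<^sup>2 < 4"
  shows "A \<in> elliptic"
proof -
  have "z \<notin> \<real>" if ev: "eigenvalue (map_matrix complex_of_real A) z" for z
  proof
    assume "z \<in> \<real>"
    then obtain r where z: "z = of_real r" by (auto elim: Reals_cases)
    have "trace (map_matrix complex_of_real A) = of_real (trace A)"
      "det (map_matrix complex_of_real A) = of_real (det A)"
      by (simp_all add: trace_2 det_2 map_matrix_def)
    hence "complex_of_real (r * r - trace A * r + det A) = 0"
      using ev unfolding eigenvalue_iff z by simp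
    hence "r * r - trace A * r + 1 = 0" using assms(1) by (simp only: of_real_eq_0_iff)
    hence "(2 * r - trace A)\<^sup>2 = (trace A)\<^sup>2 - 4" by (simp add: power2_eq_square algebra_simps)
    thus False using assms(2) zero_le_power2[of "2 * r - trace A"] by linarith
  qed
  thus ?thesis using assms(1) by (simp add: elliptic_def)
qed

text \<open>The equation det = 1 solved for the lower right entry. The inverse chart only reads off
  three entries and is therefore linear.\<close>

definition sl2_chart :: "real \<Rightarrow> real \<Rightarrow> real \<Rightarrow> mat2" where
  "sl2_chart a b c = vector [vector [a, b], vector [c, (1 + b * c) / a]]"

lemma sl2_chart_simps [simp]:
  "sl2_chart a b c $ 1 $ 1 = a" "sl2_chart a b c $ 1 $ 2 = b"
  "sl2_chart a b c $ 2 $ 1 = c" "sl2_chart a b c $ 2 $ 2 = (1 + b * c) / a"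
  by (simp_all add: sl2_chart_def)

lemma det_sl2_chart: "a \<noteq> 0 \<Longrightarrow> det (sl2_chart a b c) = 1"
  by (simp add: det_2)

lemma sl2_chart_entries: "det A = 1 \<Longrightarrow> A$1$1 \<noteq> 0 \<Longrightarrow> sl2_chart (A$1$1) (A$1$2) (A$2$1) = A"
  by (simp add: mat2_eq_iff det_2 field_simps)

definition pair_chart :: "real^6 \<Rightarrow> mat2 \<times> mat2" where
  "pair_chart x = (sl2_chart (x$1) (x$2) (x$3), sl2_chart (x$4) (x$5) (x$6))"

definition pair_coords :: "mat2 \<times> mat2 \<Rightarrow> real^6" where
  "pair_coords P = (\<chi> i. if i = 1 then fst P$1$1 else if i = 2 then fst P$1$2 else if i = 3 then fst P$2$1
    else if i = 4 then snd P$1$1 else if i = 5 then snd P$1$2 else snd P$2$1)"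

lemma pair_coords_chart: "pair_coords (pair_chart x) = x"
  using exhaust_6 by (auto simp: vec_eq_iff pair_coords_def pair_chart_def)

lemma pair_chart_coords:
  assumes "det A = 1" "A$1$1 \<noteq> 0" "det B = 1" "B$1$1 \<noteq> 0"
  shows "pair_chart (pair_coords (A, B)) = (A, B)"
  using assms by (simp add: pair_chart_def pair_coords_def sl2_chart_entries)

lemma bounded_linear_pair_coords: "bounded_linear pair_coords"
  by (intro linear_conv_bounded_linear[THEN iffD1] linearI)
     (auto simp: vec_eq_iff pair_coords_def)

text \<open>Positive upper left entries keep the chart defined. One chart is enough, as only a set
  of positive measure is sought.\<close>

definition he_piece :: "(mat2 \<times> mat2) set" where
  "he_piece = {(A, B). A$1$1 > 0 \<and> B$1$1 > 0 \<and> (trace A)\<^sup>2 > 4 \<and> (trace B)\<^sup>2 < 4}"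

lemma open_he_piece: "open he_piece"
  unfolding he_piece_def case_prod_unfold trace_2
  by (intro open_Collect_conj open_Collect_less continuous_intros)

definition chart_dom :: "(real^6) set" where
  "chart_dom = {x. x$1 > 0 \<and> x$4 > 0 \<and> pair_chart x \<in> he_piece}"

lemma continuous_on_pair_chart: "continuous_on {x. x$1 > 0 \<and> x$4 > 0} pair_chart"
proof -
  have "continuous_on {x. x$1 > 0 \<and> x$4 > 0}
      (\<lambda>x::real^6. sl2_chart (x$i) (x$j) (x$k))" if "i \<in> {1, 4}" for i j k
  proof -
    have "continuous_on {x. x$1 > 0 \<and> x$4 > 0} (\<lambda>x::real^6. (1 + x$j * x$k) / x$i)"
      using that by (intro continuous_intros) auto
    hence "continuous_on {x. x$1 > 0 \<and> x$4 > 0} (\<lambda>x::real^6. sl2_chart (x$i) (x$j) (x$k) $ r $ s)" for r s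
      using exhaust_2[of r] exhaust_2[of s]
      by (elim disjE) (simp_all add: continuous_on_component)
    hence "continuous_on {x. x$1 > 0 \<and> x$4 > 0}
        (\<lambda>x::real^6. \<chi> r s. sl2_chart (x$i) (x$j) (x$k) $ r $ s)"
      by (intro continuous_on_vec_lambda)
    thus ?thesis by (simp add: vec_lambda_eta)
  qed
  thus ?thesis unfolding pair_chart_def by (intro continuous_on_Pair) auto
qed

lemma open_chart_dom: "open chart_dom"
proof -
  have "open ({x::real^6. x$1 > 0 \<and> x$4 > 0} \<inter> pair_chart -` he_piece)"
    by (intro continuous_open_preimage continuous_on_pair_chart open_he_piece
        open_Collect_conj open_Collect_less continuous_intros)
  thus ?thesis by (simp add: chart_dom_def Int_def vimage_def conj_assoc)
qed

lemma smooth_pair_chart: "Ck_on k chart_dom pair_chart"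
proof -
  note S = open_chart_dom
  define E :: "2 \<Rightarrow> 2 \<Rightarrow> mat2" where "E i j = axis i (axis j 1)" for i j
  have comp: "Ck_on k chart_dom (\<lambda>x. x$i)" for i
    by (rule Ck_on_linear[OF S bounded_linear_vec_nth])
  note mult = Ck_on_bilinear[OF bounded_bilinear_mult S]
  note scale = Ck_on_bilinear[OF bounded_bilinear_scaleR S]
  have inv: "Ck_on k chart_dom (\<lambda>x. inverse (x$i))" if "i \<in> {1, 4}" for i
    using that by (intro Ck_on_inverse[OF S] comp) (auto simp: chart_dom_def)
  \<comment> \<open>The chart as a combination of matrix units, a form in which the closure rules
    apply directly.\<close>
  define f where "f x =
      (x$1 *\<^sub>R (E 1 1, 0) + (x$2 *\<^sub>R (E 1 2, 0) + (x$3 *\<^sub>R (E 2 1, 0) + ((1 + x$2 * x$3) * inverse (x$1)) *\<^sub>R (E 2 2, 0))))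
    + (x$4 *\<^sub>R (0, E 1 1) + (x$5 *\<^sub>R (0, E 1 2) + (x$6 *\<^sub>R (0, E 2 1) + ((1 + x$5 * x$6) * inverse (x$4)) *\<^sub>R (0, E 2 2))))"
    for x :: "real^6"
  have "f = pair_chart"
    by (auto simp: fun_eq_iff f_def pair_chart_def mat2_eq_iff E_def axis_def divide_inverse)
  moreover have "Ck_on k chart_dom f"
    unfolding f_def by (intro Ck_on_add[OF S] scale mult comp inv Ck_on_const[OF S]) auto
  ultimately show ?thesis by simp
qed

lemma pair_chart_differentiable: "x \<in> chart_dom \<Longrightarrow> pair_chart differentiable (at x)"
  using smooth_pair_chart[of 1] by simp

lemma image_pair_chart: "pair_chart ` chart_dom = (hyperbolic \<times> elliptic) \<inter> he_piece"
proof (intro set_eqI iffI)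
  fix P assume "P \<in> pair_chart ` chart_dom"
  then obtain x where x: "x \<in> chart_dom" "P = pair_chart x" by blast
  thus "P \<in> (hyperbolic \<times> elliptic) \<inter> he_piece"
    by (auto simp: chart_dom_def pair_chart_def he_piece_def det_sl2_chart
        intro!: hyperbolicI ellipticI)
next
  fix P assume P: "P \<in> (hyperbolic \<times> elliptic) \<inter> he_piece"
  obtain A B where AB: "P = (A, B)" by (cases P)
  have eq: "pair_chart (pair_coords P) = P"
    unfolding AB using P by (intro pair_chart_coords) (auto simp: AB hyperbolic_def elliptic_def he_piece_def)
  have "pair_coords P \<in> chart_dom"
    unfolding chart_dom_def using P by (simp add: eq) (simp add: AB pair_coords_def he_piece_def)
  thus "P \<in> pair_chart ` chart_dom" using eq by (metis imageI)
qed

text \<open>The linear left inverse \<open>pair_coords\<close> supplies the continuous inverse;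
  differentiating the composition, which is the identity, shows that the derivative of the chart is
  injective.\<close>

lemma local_parametrization_pair_chart:
  "local_parametrization (hyperbolic \<times> elliptic) chart_dom pair_chart"
  unfolding local_parametrization_def
proof (intro conjI ballI)
  show "open chart_dom" by (rule open_chart_dom)
  show "smooth_on chart_dom pair_chart" by (simp add: smooth_on_def smooth_pair_chart)
  show "openin (top_of_set (hyperbolic \<times> elliptic)) (pair_chart ` chart_dom)"
    unfolding image_pair_chart by (intro openin_open_Int open_he_piece)
  show "\<exists>\<phi>. homeomorphism chart_dom (pair_chart ` chart_dom) pair_chart \<phi>"
  proof
    show "homeomorphism chart_dom (pair_chart ` chart_dom) pair_chart pair_coords"
    proof (rule homeomorphismI)
      show "continuous_on chart_dom pair_chart"
        using smooth_pair_chart[of 0] by simp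
      show "continuous_on (pair_chart ` chart_dom) pair_coords"
        by (rule linear_continuous_on[OF bounded_linear_pair_coords])
    qed (auto simp: pair_coords_chart)
  qed
next
  fix x assume x: "x \<in> chart_dom"
  let ?D = "frechet_derivative pair_chart (at x)"
  have "(pair_chart has_derivative ?D) (at x)"
    using pair_chart_differentiable[OF x] by (simp add: frechet_derivative_works)
  hence "((\<lambda>x. pair_coords (pair_chart x)) has_derivative (\<lambda>v. pair_coords (?D v))) (at x)"
    by (rule bounded_linear.has_derivative[OF bounded_linear_pair_coords])
  hence "((\<lambda>x. x) has_derivative (\<lambda>v. pair_coords (?D v))) (at x)"
    by (simp add: pair_coords_chart)
  hence "(\<lambda>v. pair_coords (?D v)) = (\<lambda>v. v)"
    by (rule has_derivative_unique) (rule has_derivative_ident)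
  thus "inj ?D" by (metis inj_on_inverseI)
qed

section \<open>From null sets in the submanifold to null sets of matrix pairs\<close>

text \<open>The null set is first enlarged to a Borel null set, so that the product measure of
  \<open>lborel\<close> with itself applies.\<close>

lemma negligible_UNIV_Times:
  fixes N :: "'b::euclidean_space set"
  assumes "negligible N"
  shows "negligible ((UNIV :: 'a::euclidean_space set) \<times> N)"
proof -
  obtain N' where N': "N' \<in> null_sets lborel" "N \<subseteq> N'"
    using assms unfolding negligible_iff_null_sets null_sets_completion_iff2 by blast
  have "UNIV \<times> N' \<in> null_sets (lborel \<Otimes>\<^sub>M lborel :: ('a \<times> 'b) measure)"
    by (rule lborel.times_in_null_sets2[OF _ N'(1)]) simp
  hence "(UNIV :: 'a set) \<times> N' \<in> null_sets lborel" by (simp only: lborel_prod)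
  hence "negligible ((UNIV :: 'a set) \<times> N')"
    unfolding negligible_iff_null_sets by (rule null_sets_completionI)
  thus ?thesis by (rule negligible_subset) (use N'(2) in auto)
qed

text \<open>The conjecture concerns a submanifold of codimension two. The two scaling factors
  together with the six coordinates form a space of dimension 8, and a differentiable map into the
  8-dimensional space of pairs sends null sets to null sets.\<close>

lemma negligible_cone_over_nonresistant:
  assumes "Bochi_Fayad_conjecture"
  shows "negligible {(\<alpha> *\<^sub>R A, \<beta> *\<^sub>R B) | \<alpha> \<beta> A B.
    (A, B) \<in> (hyperbolic \<times> elliptic) \<inter> he_piece \<and> \<not> resistant A B}"
proof -
  define N where "N = {x \<in> chart_dom. pair_chart x \<in>
    {(A1, A2). (A1, A2) \<in> hyperbolic \<times> elliptic \<and> \<not> resistant A1 A2}}"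
  have "N \<in> null_sets lebesgue"
    using assms local_parametrization_pair_chart
    unfolding Bochi_Fayad_conjecture_def null_in_submanifold_def N_def by blast
  hence N: "negligible N" by (simp add: negligible_iff_null_sets)
  define \<Psi> :: "(real \<times> real) \<times> (real^6) \<Rightarrow> mat2 \<times> mat2" where
    "\<Psi> y = (fst (fst y) *\<^sub>R fst (pair_chart (snd y)), snd (fst y) *\<^sub>R snd (pair_chart (snd y)))" for y
  have "\<Psi> differentiable_on (UNIV \<times> N)"
  proof (rule differentiable_at_imp_differentiable_on)
    fix y :: "(real \<times> real) \<times> (real^6)"
    assume "y \<in> UNIV \<times> N"
    hence "snd y \<in> chart_dom" by (auto simp: N_def)
    then obtain D where "(pair_chart has_derivative D) (at (snd y))"
      using pair_chart_differentiable by (auto simp: differentiable_def)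
    hence D: "((\<lambda>y. pair_chart (snd y)) has_derivative (\<lambda>v. D (snd v))) (at y)"
      by (rule has_derivative_compose[OF has_derivative_snd[OF has_derivative_ident]])
    show "\<Psi> differentiable (at y)"
      unfolding \<Psi>_def differentiable_def
      by (rule exI, rule has_derivative_Pair)
         (rule derivative_eq_intros has_derivative_fst has_derivative_snd has_derivative_ident D refl)+
  qed
  hence "negligible (\<Psi> ` (UNIV \<times> N))"
    by (intro negligible_differentiable_image_negligible negligible_UNIV_Times N) simp_all
  moreover have "{(\<alpha> *\<^sub>R A, \<beta> *\<^sub>R B) | \<alpha> \<beta> A B.
    (A, B) \<in> (hyperbolic \<times> elliptic) \<inter> he_piece \<and> \<not> resistant A B} \<subseteq> \<Psi> ` (UNIV \<times> N)"
  proof (clarify)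
    fix \<alpha> \<beta> A B
    assume AB: "(A, B) \<in> he_piece" "A \<in> hyperbolic" "B \<in> elliptic" "\<not> resistant A B"
    hence "(A, B) \<in> pair_chart ` chart_dom" by (simp add: image_pair_chart)
    then obtain x where x: "x \<in> chart_dom" "pair_chart x = (A, B)" by (metis imageE)
    hence "x \<in> N" using AB by (simp add: N_def)
    moreover have "\<Psi> ((\<alpha>, \<beta>), x) = (\<alpha> *\<^sub>R A, \<beta> *\<^sub>R B)" by (simp add: \<Psi>_def x)
    ultimately show "(\<alpha> *\<^sub>R A, \<beta> *\<^sub>R B) \<in> \<Psi> ` (UNIV \<times> N)" by (metis UNIV_I image_eqI mem_Sigma_iff)
  qed
  ultimately show ?thesis by (rule negligible_subset)
qed

section \<open>A set of resistant pairs of positive measure\<close>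

text \<open>Strict inequalities make the set open. The entry, trace and determinant signs put the
  rescaled pair into \<open>he_piece\<close>; the remaining determinant bounds are those needed to
  find the exponents.\<close>

definition good_pairs :: "(mat2 \<times> mat2) set" where
  "good_pairs = {(A, B). A$1$1 > 0 \<and> 1/1024 < det A \<and> det A < 1/16 \<and> trace A > 0 \<and>
    (trace A)\<^sup>2 > 4 * det A \<and> opnorm A < 1/2 \<and> B$1$1 > 0 \<and> det B > 0 \<and>
    (trace B)\<^sup>2 < 4 * det B \<and> det A < (det B)\<^sup>2 \<and> opnorm B < 1/2}"

lemma open_good_pairs: "open good_pairs"
proof -
  have "continuous_on UNIV (\<lambda>P :: mat2 \<times> mat2. opnorm (fst P))"
    "continuous_on UNIV (\<lambda>P :: mat2 \<times> mat2. opnorm (snd P))"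
    by (intro continuous_on_compose2[OF continuous_on_opnorm[of UNIV]] continuous_intros subset_UNIV)+
  thus ?thesis
    unfolding good_pairs_def case_prod_unfold trace_2 det_2
    by (intro open_Collect_conj open_Collect_less continuous_intros)
qed

lemma good_pairs_nonempty: "good_pairs \<noteq> {}"
proof -
  \<comment> \<open>\<open>B\<close> is a rotation with cosine 3/5 and sine 4/5, scaled by 1/3. Thus
    \<open>(det B)\<^sup>2 = 1/81\<close> exceeds \<open>det A = 1/400\<close>.\<close>
  define A B :: mat2 where "A = vector [vector [1/4, 0], vector [0, 1/100]]"
    and "B = vector [vector [1/5, - 4/15], vector [4/15, 1/5]]"
  have "opnorm A \<le> 1/4" unfolding A_def by (rule opnorm_diag_le) auto
  moreover have "opnorm B \<le> 1/3"
  proof (rule opnorm_le)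
    fix x
    have "(norm (B *v x))\<^sup>2 = (1/3 * norm x)\<^sup>2"
      unfolding norm_2_sq power_mult_distrib
      by (simp add: B_def matrix_vector_mult_2 power2_eq_square field_simps)
    hence "(norm (B *v x))\<^sup>2 \<le> (1/3 * norm x)\<^sup>2" by (rule eq_refl)
    thus "norm (B *v x) \<le> 1/3 * norm x" by (rule power2_le_imp_le) simp
  qed
  ultimately have "(A, B) \<in> good_pairs"
    by (simp add: good_pairs_def det_2 trace_2) (simp add: A_def B_def power2_eq_square)
  thus ?thesis by blast
qed

definition radius :: "mat2 \<times> mat2 \<Rightarrow> nat \<Rightarrow> real" where
  "radius P i = (if i = 1 then sqrt (det (fst P)) else sqrt (det (snd P)))"

text \<open>Resistance of the rescaled pair with \<open>c\<close>, \<open>e\<close> and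
  \<open>L - 1\<close> all equal to \<open>1 / Suc k\<close>. Moving the determinants to the left
  through \<open>radius\<close> avoids division and leaves inequalities between functions continuous
  on the whole space, so the set is closed and hence measurable.\<close>

definition scaled_resistant :: "nat \<Rightarrow> (mat2 \<times> mat2) set" where
  "scaled_resistant k = {P. \<forall>n w. n \<ge> 1 \<longrightarrow> w \<in> words n \<longrightarrow>
    real (count_list w 2) \<le> inverse (real (Suc k)) * real n \<longrightarrow>
    inverse (real (Suc k)) * (1 + inverse (real (Suc k))) ^ n * prod_list (map (radius P) w)
      \<le> opnorm (word_prod (fst P) (snd P) w)}"

lemma continuous_on_matrix_mult:
  fixes f g :: "'a::topological_space \<Rightarrow> mat2"
  shows "continuous_on S f \<Longrightarrow> continuous_on S g \<Longrightarrow> continuous_on S (\<lambda>x. f x ** g x)"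
  unfolding matrix_matrix_mult_def by (intro continuous_intros)

lemma closed_scaled_resistant: "closed (scaled_resistant k)"
proof -
  have "continuous_on UNIV (\<lambda>P. word_prod (fst P) (snd P) w)" for w
  proof (induction w)
    case (Cons i w)
    thus ?case by (cases "i = 1") (auto intro!: continuous_on_matrix_mult continuous_intros)
  qed simp
  hence norm: "continuous_on UNIV (\<lambda>P. opnorm (word_prod (fst P) (snd P) w))" for w
    by (rule continuous_on_compose2[OF continuous_on_opnorm[of UNIV]]) auto
  have "continuous_on UNIV (\<lambda>P. radius P i)" for i
    unfolding radius_def det_2 by (cases "i = 1") (auto intro!: continuous_intros)
  hence "continuous_on UNIV (\<lambda>P. prod_list (map (radius P) w))" for w
    by (induction w) (auto intro!: continuous_intros)
  thus ?thesis
    unfolding scaled_resistant_def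
    by (intro closed_Collect_all closed_Collect_imp open_Collect_const closed_Collect_le continuous_intros norm)
qed

lemma word_prod_scaleR:
  "word_prod (\<alpha> *\<^sub>R A) (\<beta> *\<^sub>R B) w
    = prod_list (map (\<lambda>i. if i = 1 then \<alpha> else \<beta>) w) *\<^sub>R word_prod A B w"
proof (induction w)
  case (Cons i w)
  have scale: "(r *\<^sub>R M) ** (s *\<^sub>R N) = (r * s) *\<^sub>R (M ** N)" for r s and M N :: mat2
    by (simp add: mat2_eq_iff matrix_mult_2 algebra_simps)
  show ?case by (simp add: Cons.IH scale)
qed simp

text \<open>Resistance survives when \<open>c\<close>, \<open>e\<close> and \<open>L - 1\<close> are
  all lowered to one small \<open>1 / Suc k\<close>, and scaling multiplies both sides of the
  estimate by the same product of factors.\<close>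

lemma scaled_resistantI:
  assumes \<alpha>\<beta>: "\<alpha> > 0" "\<beta> > 0" and det: "det A = 1" "det B = 1" and res: "resistant A B"
  shows "\<exists>k. (\<alpha> *\<^sub>R A, \<beta> *\<^sub>R B) \<in> scaled_resistant k"
proof -
  obtain c e L where cel: "c > 0" "e > 0" "L > 1" and r: "resistant_with c e L A B"
    using res by (auto simp: resistant_def)
  obtain k where k: "inverse (real (Suc k)) < min (min c e) (L - 1)"
    using reals_Archimedean[of "min (min c e) (L - 1)"] cel by auto
  define d where "d = inverse (real (Suc k))"
  have d: "0 < d" "d \<le> c" "d \<le> e" "1 + d \<le> L" using k by (simp_all add: d_def)
  have rad: "radius (\<alpha> *\<^sub>R A, \<beta> *\<^sub>R B) = (\<lambda>i. if i = 1 then \<alpha> else \<beta>)"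
    using \<alpha>\<beta> by (auto simp: radius_def det_scaleR_2 det)
  have "d * (1 + d) ^ n * prod_list (map (radius (\<alpha> *\<^sub>R A, \<beta> *\<^sub>R B)) w)
      \<le> opnorm (word_prod (\<alpha> *\<^sub>R A) (\<beta> *\<^sub>R B) w)"
    if n: "n \<ge> 1" "w \<in> words n" "real (count_list w 2) \<le> d * real n" for n w
  proof -
    let ?g = "prod_list (map (\<lambda>i. if i = 1 then \<alpha> else \<beta>) w)"
    have g: "0 < ?g" using \<alpha>\<beta> by (intro prod_list_map_pos) auto
    have "d * real n \<le> e * real n" using d by (intro mult_right_mono) auto
    hence "real (count_list w 2) \<le> e * real n" using n(3) by linarith
    hence "c * L ^ n \<le> opnorm (word_prod A B w)"
      using r n(1,2) unfolding resistant_with_def by blast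
    moreover have "d * (1 + d) ^ n \<le> c * L ^ n"
      using d cel by (intro mult_mono power_mono) auto
    ultimately have "d * (1 + d) ^ n * ?g \<le> opnorm (word_prod A B w) * ?g"
      using g by (intro mult_right_mono) auto
    thus ?thesis using g by (simp add: rad word_prod_scaleR opnorm_scaleR mult.commute)
  qed
  thus ?thesis unfolding scaled_resistant_def d_def by auto
qed

text \<open>Division by the square roots of the determinants leads into the submanifold, where the
  pair is either resistant, with some index \<open>k\<close>, or one of those covered by the
  conjecture.\<close>

lemma good_pairs_subset:
  "good_pairs \<subseteq> {(\<alpha> *\<^sub>R A, \<beta> *\<^sub>R B) | \<alpha> \<beta> A B.
      (A, B) \<in> (hyperbolic \<times> elliptic) \<inter> he_piece \<and> \<not> resistant A B}
    \<union> (\<Union>k. good_pairs \<inter> scaled_resistant k)"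
proof
  fix P assume P: "P \<in> good_pairs"
  obtain A B where AB: "P = (A, B)" by (cases P)
  define \<alpha> \<beta> where "\<alpha> = sqrt (det A)" and "\<beta> = sqrt (det B)"
  have good: "A$1$1 > 0" "det A > 0" "(trace A)\<^sup>2 > 4 * det A" "B$1$1 > 0" "det B > 0" "(trace B)\<^sup>2 < 4 * det B"
    using P by (auto simp: good_pairs_def AB)
  hence pos: "\<alpha> > 0" "\<beta> > 0" "\<alpha>\<^sup>2 = det A" "\<beta>\<^sup>2 = det B" by (simp_all add: \<alpha>_def \<beta>_def)
  define H E where "H = (1 / \<alpha>) *\<^sub>R A" and "E = (1 / \<beta>) *\<^sub>R B"
  have P_eq: "P = (\<alpha> *\<^sub>R H, \<beta> *\<^sub>R E)" using pos by (simp add: AB H_def E_def)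
  have det: "det H = 1" "det E = 1"
    using good by (simp_all add: H_def E_def det_scaleR_2 power_divide pos)
  have tr: "(trace H)\<^sup>2 > 4" "(trace E)\<^sup>2 < 4"
    using good by (simp_all add: H_def E_def trace_scaleR power_divide power_mult_distrib pos field_simps)
  have entry: "H$1$1 > 0" "E$1$1 > 0" using good pos by (simp_all add: H_def E_def)
  have "(H, E) \<in> (hyperbolic \<times> elliptic) \<inter> he_piece"
    using hyperbolicI[OF det(1) tr(1)] ellipticI[OF det(2) tr(2)] tr entry
    by (simp add: he_piece_def)
  moreover have "\<exists>k. P \<in> scaled_resistant k" if "resistant H E"
    unfolding P_eq by (rule scaled_resistantI[OF pos(1,2) det that])
  ultimately show "P \<in> {(\<alpha> *\<^sub>R A, \<beta> *\<^sub>R B) | \<alpha> \<beta> A B.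
      (A, B) \<in> (hyperbolic \<times> elliptic) \<inter> he_piece \<and> \<not> resistant A B}
    \<union> (\<Union>k. good_pairs \<inter> scaled_resistant k)"
    using P P_eq by blast
qed

lemma discontinuity_set_of_positive_measure:
  assumes "Bochi_Fayad_conjecture"
  obtains X Q where "X \<in> sets lebesgue" "emeasure lebesgue X > 0" "X \<subseteq> good_pairs" "Q > 1"
    "\<And>p q P. \<lbrakk>1/2 \<le> p; p < 1; q > Q; P \<in> X\<rbrakk> \<Longrightarrow> r_discontinuous_at q p P"
proof -
  have "\<exists>k. \<not> negligible (good_pairs \<inter> scaled_resistant k)"
  proof (rule ccontr)
    assume "\<nexists>k. \<not> negligible (good_pairs \<inter> scaled_resistant k)"
    hence "negligible S" if "S \<in> range (\<lambda>k. good_pairs \<inter> scaled_resistant k)" for S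
      using that by blast
    hence "negligible (\<Union>k. good_pairs \<inter> scaled_resistant k)"
      by (intro negligible_countable_Union) simp_all
    with negligible_cone_over_nonresistant[OF assms] have "negligible good_pairs"
      by (intro negligible_subset[OF _ good_pairs_subset] negligible_Un)
    thus False using open_not_negligible[OF open_good_pairs good_pairs_nonempty] by blast
  qed
  then obtain k where k: "\<not> negligible (good_pairs \<inter> scaled_resistant k)" ..
  define X where "X = good_pairs \<inter> scaled_resistant k"
  have "X \<in> sets borel"
    unfolding X_def by (intro sets.Int borel_open borel_closed open_good_pairs closed_scaled_resistant)
  hence X: "X \<in> sets lebesgue" by (intro sets_completionI_sets) simp
  have "emeasure lebesgue X > 0"
    using k[folded X_def] X unfolding negligible_iff_null_sets null_sets_def
    by (simp add: zero_less_iff_neq_zero)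
  define d where "d = inverse (real (Suc k))"
  have d: "d > 0" "1 + d > 1" by (simp_all add: d_def)
  obtain Q where Q: "Q > 1" "\<And>p q c A B. \<lbrakk>1/2 \<le> p; p < 1; q > Q; c > 0;
    1/1024 < det A; det A < 1/16; trace A > 0; (trace A)\<^sup>2 > 4 * det A; opnorm A < 1;
    det B > 0; (trace B)\<^sup>2 < 4 * det B; det A \<le> (det B)\<^sup>2; opnorm B < 1;
    \<And>n w. n \<ge> 1 \<Longrightarrow> w \<in> words n \<Longrightarrow> real (count_list w 2) \<le> d * real n \<Longrightarrow>
      c * (1 + d) ^ n * prod_list (map (\<lambda>i. if i = 1 then sqrt (det A) else sqrt (det B)) w)
        \<le> opnorm (word_prod A B w)\<rbrakk> \<Longrightarrow> r_discontinuous_at q p (A, B)"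
    using r_discontinuous_at_resistant[OF d(2,1)] by blast
  show ?thesis
  proof (rule that[OF X \<open>emeasure lebesgue X > 0\<close> _ Q(1)])
    fix p q :: real and P
    assume pq: "1/2 \<le> p" "p < 1" "q > Q" and P: "P \<in> X"
    obtain A B where AB: "P = (A, B)" by (cases P)
    have rad: "radius P = (\<lambda>i. if i = 1 then sqrt (det A) else sqrt (det B))"
      by (auto simp: radius_def AB)
    show "r_discontinuous_at q p P"
      unfolding AB
    proof (rule Q(2)[OF pq d(1)])
      show "d * (1 + d) ^ n * prod_list (map (\<lambda>i. if i = 1 then sqrt (det A) else sqrt (det B)) w)
        \<le> opnorm (word_prod A B w)"
        if "n \<ge> 1" "w \<in> words n" "real (count_list w 2) \<le> d * real n" for n w
        using P that unfolding X_def scaled_resistant_def d_def rad[symmetric] by (auto simp: AB)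
    qed (use P in \<open>auto simp: X_def good_pairs_def AB\<close>)
  qed (simp add: X_def)
qed

theorem theorem1p3:
  shows
    "(\<forall>q p \<delta> l :: real.
        q > 1 \<and> 0 < p \<and> p < 1 \<and> 0 < \<delta> \<and> \<delta> < l \<and> l < 1 / 2 \<and>
        ln (min (p powr q) ((1 - p) powr q)) / ln (sqrt (l * \<delta>))
          < ln (p powr q + (1 - p) powr q) / ln l \<longrightarrow>
        r_discontinuous_at q p
          (vector [vector [l, 0], vector [0, \<delta>]], vector [vector [l, 0], vector [0, l]])) \<and>
     (Bochi_Fayad_conjecture \<longrightarrow>
       (\<exists>X :: (mat2 \<times> mat2) set.
          X \<in> sets lebesgue \<and> emeasure lebesgue X > 0 \<and>
          (\<forall>(A1, A2)\<in>X. opnorm A1 < 1 / 2 \<and> opnorm A2 < 1 / 2) \<and>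
          (\<exists>Q>1. \<forall>p q. 1 / 2 \<le> p \<and> p < 1 \<and> q > Q \<longrightarrow>
             (\<forall>P\<in>X. r_discontinuous_at q p P))))"
proof (intro conjI impI allI)
  fix q p \<delta> l :: real
  assume "q > 1 \<and> 0 < p \<and> p < 1 \<and> 0 < \<delta> \<and> \<delta> < l \<and> l < 1 / 2 \<and>
    ln (min (p powr q) ((1 - p) powr q)) / ln (sqrt (l * \<delta>))
      < ln (p powr q + (1 - p) powr q) / ln l"
  thus "r_discontinuous_at q p
      (vector [vector [l, 0], vector [0, \<delta>]], vector [vector [l, 0], vector [0, l]])"
    by (intro r_discontinuous_at_diagonal) blast+
next
  assume "Bochi_Fayad_conjecture"
  then obtain X Q where X: "X \<in> sets lebesgue" "emeasure lebesgue X > 0" "X \<subseteq> good_pairs" "Q > 1"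
    "\<And>p q P. \<lbrakk>1/2 \<le> p; p < 1; q > Q; P \<in> X\<rbrakk> \<Longrightarrow> r_discontinuous_at q p P"
    by (rule discontinuity_set_of_positive_measure) blast
  have "\<forall>(A1, A2)\<in>X. opnorm A1 < 1 / 2 \<and> opnorm A2 < 1 / 2"
    using X(3) by (auto simp: good_pairs_def)
  thus "\<exists>X :: (mat2 \<times> mat2) set.
      X \<in> sets lebesgue \<and> emeasure lebesgue X > 0 \<and>
      (\<forall>(A1, A2)\<in>X. opnorm A1 < 1 / 2 \<and> opnorm A2 < 1 / 2) \<and>
      (\<exists>Q>1. \<forall>p q. 1 / 2 \<le> p \<and> p < 1 \<and> q > Q \<longrightarrow>
         (\<forall>P\<in>X. r_discontinuous_at q p P))"
    using X by (intro exI[of _ X] conjI exI[of _ Q]) auto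
qed

end
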